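(* Let $(\Omega,\cdot,\mathbb{R})$ be a minimal and uniquely ergodic continuous flow on a compact metric space $\Omega$, and consider a family of linear cooperative delay systems over $\Omega$, $$y'(t)=A(\omega\cdot t)\,y(t)+B(\omega\cdot t)\,y(t-1),\quad \omega\in\Omega, \qquad (L_\omega)$$ where $A,B:\Omega\to M_n(\mathbb{R})$ are continuous maps into the $n\times n$ real matrices. Assume that for a certain $\omega_0\in\Omega$ the system $(L_{\omega_0})$ is uniformly persistent, that is, there exists $m>0$ such that for every initial map $\varphi\in C([-1,0],\mathbb{R}^n)$ with $\varphi\gg0$ there is a time $t_0=t_0(\omega_0,\varphi)$ such that $$y_i(t,\omega_0,\varphi)\ge m\quad\text{for all } t\ge t_0\text{ and all } i=1,\dots,n,$$ whereas the whole family of systems over $\Omega$ is not uniformly persistent. Then there exists an invariant, residual set $\Omega_1\subset\Omega$ of full measure such that for every $\omega\in\Omega_1$ the system $(L_\omega)$ is not uniformly persistent.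
   Context: The flow on $\Omega$ is written $(t,\omega)\mapsto\omega\cdot t$. Minimal: every orbit is dense. Uniquely ergodic: there is a unique flow-invariant Borel probability measure on $\Omega$; "full measure" refers to it. Invariant: $\Omega_1\cdot t=\Omega_1$ for all $t\in\mathbb{R}$. Residual: the complement is of first Baire category. Cooperative: for every $\omega\in\Omega$ all off-diagonal entries of $A(\omega)$ and all entries of $B(\omega)$ are nonnegative. $X=C([-1,0],\mathbb{R}^n)$; for $\varphi,\psi\in X$, $\varphi\ge\psi$ means $\varphi_i(s)\ge\psi_i(s)$ for all $i$ and $s\in[-1,0]$; $\varphi\gg0$ means $\varphi_i(s)>0$ for all $i$ and $s\in[-1,0]$. $y(t,\omega,\varphi)$ is the solution of $(L_\omega)$ with $y(s)=\varphi(s)$ on $[-1,0]$, and $y_t(\omega,\varphi)\in X$ is $y_t(\omega,\varphi)(s)=y(t+s,\omega,\varphi)$. A single system $(L_\omega)$ is uniformly persistent if the condition displayed in the claim holds with $\omega$ in place of $\omega_0$ (for some $m>0$). The whole family is uniformly persistent if there exists $\psi\in X$, $\psi\gg0$, such that for every $\omega\in\Omega$ and every $\varphi\gg0$ there is $t_0=t_0(\omega,\varphi)$ with $y_t(\omega,\varphi)\ge\psi$ for all $t\ge t_0$. *)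

theory Defs
  imports "HOL-Probability.Probability"
begin

definition continuous_flow :: "(real \<Rightarrow> 'w::metric_space \<Rightarrow> 'w) \<Rightarrow> bool" where
  "continuous_flow \<sigma> \<longleftrightarrow>
     continuous_on UNIV (\<lambda>(t, \<omega>). \<sigma> t \<omega>) \<and>
     (\<forall>\<omega>. \<sigma> 0 \<omega> = \<omega>) \<and>
     (\<forall>s t \<omega>. \<sigma> (s + t) \<omega> = \<sigma> t (\<sigma> s \<omega>))"

definition minimal_flow :: "(real \<Rightarrow> 'w::metric_space \<Rightarrow> 'w) \<Rightarrow> bool" where
  "minimal_flow \<sigma> \<longleftrightarrow> (\<forall>\<omega>. closure (range (\<lambda>t. \<sigma> t \<omega>)) = UNIV)"

definition invariant_prob :: "(real \<Rightarrow> 'w::metric_space \<Rightarrow> 'w) \<Rightarrow> 'w measure \<Rightarrow> bool" where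
  "invariant_prob \<sigma> \<mu> \<longleftrightarrow>
     sets \<mu> = sets borel \<and> prob_space \<mu> \<and> (\<forall>t. distr \<mu> borel (\<sigma> t) = \<mu>)"

definition uniquely_ergodic :: "(real \<Rightarrow> 'w::metric_space \<Rightarrow> 'w) \<Rightarrow> bool" where
  "uniquely_ergodic \<sigma> \<longleftrightarrow> (\<exists>!\<mu>. invariant_prob \<sigma> \<mu>)"

definition invariant_set :: "(real \<Rightarrow> 'w \<Rightarrow> 'w) \<Rightarrow> 'w set \<Rightarrow> bool" where
  "invariant_set \<sigma> S \<longleftrightarrow> (\<forall>t. \<sigma> t ` S = S)"

definition first_category :: "'w::topological_space set \<Rightarrow> bool" where
  "first_category S \<longleftrightarrow>
     (\<exists>F :: nat \<Rightarrow> 'w set. (\<forall>k. interior (closure (F k)) = {}) \<and> S = (\<Union>k. F k))"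

definition residual_set :: "'w::topological_space set \<Rightarrow> bool" where
  "residual_set S \<longleftrightarrow> first_category (- S)"

definition cooperative :: "('w \<Rightarrow> real^'n^'n) \<Rightarrow> ('w \<Rightarrow> real^'n^'n) \<Rightarrow> bool" where
  "cooperative A B \<longleftrightarrow>
     (\<forall>\<omega> i j. (i \<noteq> j \<longrightarrow> 0 \<le> A \<omega> $ i $ j) \<and> 0 \<le> B \<omega> $ i $ j)"

text \<open>
  An element of the phase space of continuous maps from \<open>[-1, 0]\<close> to \<open>\<real>\<^sup>n\<close> is represented by any
  total function continuous on \<open>{-1..0}\<close>; its values elsewhere are never used.
\<close>

definition phase_space :: "(real \<Rightarrow> real^'n) set" where
  "phase_space = {\<phi>. continuous_on {-1..0} \<phi>}"

definition phase_le :: "(real \<Rightarrow> real^'n) \<Rightarrow> (real \<Rightarrow> real^'n) \<Rightarrow> bool" where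
  "phase_le \<psi> \<phi> \<longleftrightarrow> (\<forall>s\<in>{-1..0}. \<forall>i. \<psi> s $ i \<le> \<phi> s $ i)"

definition strongly_positive :: "(real \<Rightarrow> real^'n) \<Rightarrow> bool" where
  "strongly_positive \<phi> \<longleftrightarrow> (\<forall>s\<in>{-1..0}. \<forall>i. 0 < \<phi> s $ i)"

text \<open>The derivative is one-sided at \<open>t = 0\<close>.\<close>

definition is_dde_solution ::
  "(real \<Rightarrow> 'w \<Rightarrow> 'w) \<Rightarrow> ('w \<Rightarrow> real^'n^'n) \<Rightarrow> ('w \<Rightarrow> real^'n^'n) \<Rightarrow>
     'w \<Rightarrow> (real \<Rightarrow> real^'n) \<Rightarrow> (real \<Rightarrow> real^'n) \<Rightarrow> bool" where
  "is_dde_solution \<sigma> A B \<omega> \<phi> y \<longleftrightarrow>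
     continuous_on {-1..} y \<and>
     (\<forall>s\<in>{-1..0}. y s = \<phi> s) \<and>
     (\<forall>t\<ge>0. (y has_vector_derivative
               (A (\<sigma> t \<omega>) *v y t + B (\<sigma> t \<omega>) *v y (t - 1))) (at t within {0..}))"

text \<open>
  For continuous \<open>A\<close>, \<open>B\<close>, a continuous flow and \<open>\<phi>\<close> in the phase space, a solution exists and is
  unique on \<open>{-1..}\<close>. The choice operator only has freedom below \<open>-1\<close>, where values are never used.
\<close>

definition dde_sol ::
  "(real \<Rightarrow> 'w \<Rightarrow> 'w) \<Rightarrow> ('w \<Rightarrow> real^'n^'n) \<Rightarrow> ('w \<Rightarrow> real^'n^'n) \<Rightarrow>
     'w \<Rightarrow> (real \<Rightarrow> real^'n) \<Rightarrow> real \<Rightarrow> real^'n" where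
  "dde_sol \<sigma> A B \<omega> \<phi> = (SOME y. is_dde_solution \<sigma> A B \<omega> \<phi> y)"

definition dde_segment ::
  "(real \<Rightarrow> 'w \<Rightarrow> 'w) \<Rightarrow> ('w \<Rightarrow> real^'n^'n) \<Rightarrow> ('w \<Rightarrow> real^'n^'n) \<Rightarrow>
     real \<Rightarrow> 'w \<Rightarrow> (real \<Rightarrow> real^'n) \<Rightarrow> real \<Rightarrow> real^'n" where
  "dde_segment \<sigma> A B t \<omega> \<phi> = (\<lambda>s. dde_sol \<sigma> A B \<omega> \<phi> (t + s))"

definition system_uniformly_persistent ::
  "(real \<Rightarrow> 'w \<Rightarrow> 'w) \<Rightarrow> ('w \<Rightarrow> real^'n^'n) \<Rightarrow> ('w \<Rightarrow> real^'n^'n) \<Rightarrow> 'w \<Rightarrow> bool" where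
  "system_uniformly_persistent \<sigma> A B \<omega> \<longleftrightarrow>
     (\<exists>m>0. \<forall>\<phi>\<in>phase_space. strongly_positive \<phi> \<longrightarrow>
        (\<exists>t0\<ge>0. \<forall>t\<ge>t0. \<forall>i. m \<le> dde_sol \<sigma> A B \<omega> \<phi> t $ i))"

definition family_uniformly_persistent ::
  "(real \<Rightarrow> 'w \<Rightarrow> 'w) \<Rightarrow> ('w \<Rightarrow> real^'n^'n) \<Rightarrow> ('w \<Rightarrow> real^'n^'n) \<Rightarrow> bool" where
  "family_uniformly_persistent \<sigma> A B \<longleftrightarrow>
     (\<exists>\<psi>\<in>phase_space. strongly_positive \<psi> \<and>
        (\<forall>\<omega>. \<forall>\<phi>\<in>phase_space. strongly_positive \<phi> \<longrightarrow>
           (\<exists>t0\<ge>0. \<forall>t\<ge>t0. phase_le \<psi> (dde_segment \<sigma> A B t \<omega> \<phi>))))"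

end

theory Submission
  imports Defs
begin

text \<open>
  Let \<open>u\<close> be the solution with initial map constantly \<open>1\<close> and \<open>G t \<omega>\<close> the minimum of its components
  over \<open>[t - 1, t]\<close>. By linearity and the comparison principle, persistence of the system at \<open>\<omega>\<close>
  means \<open>G t \<omega> \<rightarrow> \<infinity>\<close>, persistence of the family means that this holds at every \<open>\<omega>\<close>, and \<open>G\<close> is
  supermultiplicative along the flow. Let \<open>P\<close> be the invariant set where \<open>G t \<omega> \<rightarrow> \<infinity>\<close>; the complement
  of \<open>P\<close> is the set to be found.

  \<open>P\<close> is covered by the closed sets \<open>C\<^sub>N\<close> on which \<open>G t \<ge> 2\<close> for all \<open>t \<ge> N\<close>. If some \<open>C\<^sub>N\<close> has an
  interior point, every orbit returns to that interior again and again and \<open>G\<close> doubles each time, so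
  \<open>P\<close> is everything. If \<open>P\<close> has positive measure it has full measure by ergodicity, some \<open>C\<^sub>N\<close> has
  measure above \<open>3/4\<close>, and counting visits to it gives \<open>T\<close> with \<open>\<integral> ln (G T) d\<mu> > 0\<close>. An orbit outside
  \<open>P\<close> would yield, as a limit of its time averages, an invariant measure for which this integral is
  nonpositive, contradicting unique ergodicity.
\<close>

section \<open>Coding a compact metric space by real numbers\<close>

text \<open>Divergence of \<open>G\<close> at a point carries no rate, and the mean of
  \<open>ln (G T)\<close> must be positive for some fixed \<open>T\<close>. Only one such
  \<open>T\<close> is wanted, because superadditivity of \<open>ln G\<close> bounds a sum of
  \<open>ln (G T)\<close> over consecutive blocks by the logarithm of the growth over the whole
  stretch. Full measure of \<open>P\<close> would still allow a null set of exceptional points,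
  while persistence of the family concerns every point. Hence the passage to time averages along one
  prescribed orbit: ergodicity says nothing about such an orbit, but every limit of its averages is
  an invariant measure, and there is only one. The compactness of probability measures behind this
  limit is available on the real line, which is the reason for coding the space by numbers.\<close>

definition ternary_tail :: "(nat \<Rightarrow> 'w set) \<Rightarrow> nat \<Rightarrow> 'w \<Rightarrow> real" where
  "ternary_tail b n x = (\<Sum>k. 2 * indicator (b (n + k)) x / 3 ^ Suc k)"

lemma summable_third: "summable (\<lambda>k. 2 / 3 ^ Suc k :: real)"
  using summable_mult[OF summable_geometric[of "1/3::real"], of "2/3"]
  by (simp add: power_divide)

lemma suminf_third: "(\<Sum>k. 2 / 3 ^ Suc k :: real) = 1"
proof -
  have "(\<Sum>k. 2/3 * (1/3) ^ k :: real) = 2/3 * (1 / (1 - 1/3))"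
    using suminf_mult[OF summable_geometric[of "1/3::real"], of "2/3"] suminf_geometric[of "1/3::real"]
    by simp
  thus ?thesis by (simp add: power_divide)
qed

lemma summable_ternary: "summable (\<lambda>k. 2 * indicator (b (n + k)) x / 3 ^ Suc k :: real)"
  by (rule summable_comparison_test'[OF summable_third, of 0]) (auto simp: indicator_def)

lemma ternary_tail_bounds: "0 \<le> ternary_tail b n x" "ternary_tail b n x \<le> 1"
proof -
  show "0 \<le> ternary_tail b n x"
    unfolding ternary_tail_def by (rule suminf_nonneg[OF summable_ternary]) auto
  show "ternary_tail b n x \<le> 1"
    unfolding ternary_tail_def suminf_third[symmetric]
    by (rule suminf_le[OF _ summable_ternary summable_third]) (auto simp: indicator_def)
qed

lemma ternary_tail_step: "3 * ternary_tail b n x = 2 * indicator (b n) x + ternary_tail b (Suc n) x"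
proof -
  have "(\<Sum>k. 2 * indicator (b (n + Suc k)) x / 3 ^ Suc (Suc k) :: real)
      = (\<Sum>k. (1/3) * (2 * indicator (b (Suc n + k)) x / 3 ^ Suc k))"
    by simp
  also have "\<dots> = (1/3) * ternary_tail b (Suc n) x"
    unfolding ternary_tail_def by (rule suminf_mult[OF summable_ternary])
  finally show ?thesis
    using suminf_split_head[OF summable_ternary, of b n x] unfolding ternary_tail_def by simp
qed

text \<open>Only the digits 0 and 2 occur, so tails with different first digit lie in [2/3, 1] and
  in [0, 1/3]. This gap is the reason for base 3: in base 2 different digit sequences can have the
  same value.\<close>

lemma ternary_tail_first:
  assumes "\<bar>ternary_tail b n x - ternary_tail b n y\<bar> < 1 / 3"
  shows "x \<in> b n \<longleftrightarrow> y \<in> b n"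
proof -
  have "False" if "x \<in> b n" "y \<notin> b n" "\<bar>ternary_tail b n x - ternary_tail b n y\<bar> < 1 / 3" for x y
  proof -
    have "3 * ternary_tail b n x = 2 + ternary_tail b (Suc n) x"
      "3 * ternary_tail b n y = ternary_tail b (Suc n) y"
      using ternary_tail_step[of b n x] ternary_tail_step[of b n y] that(1,2) by auto
    then show False
      using ternary_tail_bounds(1)[of b "Suc n" x] ternary_tail_bounds(2)[of b "Suc n" y] that(3)
      by linarith
  qed
  from this[of x y] this[of y x] show ?thesis using assms by (auto simp: abs_minus_commute)
qed

text \<open>Once the first digits agree, deleting them multiplies the distance by exactly 3, so
  closeness below the power \<open>1 / 3 ^ Suc m\<close> pays for \<open>m + 1\<close>
  digits.\<close>

lemma ternary_tail_agree:
  assumes "\<bar>ternary_tail b n x - ternary_tail b n y\<bar> < 1 / 3 ^ Suc m" "j \<le> m"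
  shows "x \<in> b (n + j) \<longleftrightarrow> y \<in> b (n + j)"
  using assms
proof (induction m arbitrary: n j)
  case 0
  then show ?case using ternary_tail_first[of b n x y] by simp
next
  case (Suc m)
  have "(1::real) / 3 ^ Suc (Suc m) \<le> 1/3"
    using power_increasing[of 1 "Suc (Suc m)" "3::real"] by (simp add: field_simps)
  then have *: "x \<in> b n \<longleftrightarrow> y \<in> b n"
    using ternary_tail_first[of b n x y] Suc.prems by linarith
  have "3 * (ternary_tail b n x - ternary_tail b n y)
      = ternary_tail b (Suc n) x - ternary_tail b (Suc n) y"
    using ternary_tail_step[of b n x] ternary_tail_step[of b n y] *
    by (simp add: right_diff_distrib indicator_def)
  then have "\<bar>ternary_tail b (Suc n) x - ternary_tail b (Suc n) y\<bar>
      = 3 * \<bar>ternary_tail b n x - ternary_tail b n y\<bar>"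
    by (metis abs_mult abs_numeral)
  then have "\<bar>ternary_tail b (Suc n) x - ternary_tail b (Suc n) y\<bar> < 1 / 3 ^ Suc m"
    using Suc.prems(1) by simp
  from Suc.IH[OF this] show ?case using * Suc.prems(2)
    by (cases j) auto
qed

text \<open>Finite covers by balls of radius \<open>1 / Suc k\<close>, for all \<open>k\<close>, are
  merged into one sequence. The bound \<open>m\<close> on the index does not depend on the point;
  this uniformity later makes decoding uniformly continuous.\<close>

lemma compact_countable_fine_cover:
  assumes "compact (UNIV :: 'w::metric_space set)"
  obtains b :: "nat \<Rightarrow> 'w::metric_space set" where "\<And>k. open (b k)"
    and "\<And>e. e > 0 \<Longrightarrow> \<exists>m. \<forall>x. \<exists>k\<le>m. x \<in> b k \<and> (\<forall>y\<in>b k. dist x y < e)"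
proof -
  have "\<exists>F. finite F \<and> (\<Union>x\<in>F. ball x (1 / real (Suc k))) = (UNIV :: 'w set)" for k
  proof -
    have "(UNIV :: 'w set) \<subseteq> (\<Union>x\<in>UNIV. ball x (1 / real (Suc k)))"
      by (meson UNIV_I UN_I centre_in_ball of_nat_0_less_iff subsetI zero_less_Suc zero_less_divide_1_iff)
    then obtain F where "finite F" "(UNIV :: 'w set) \<subseteq> (\<Union>x\<in>F. ball x (1 / real (Suc k)))"
      using compactE_image[OF assms, of UNIV "\<lambda>x. ball x (1 / real (Suc k))"] by auto
    then show ?thesis by blast
  qed
  then obtain F where F: "\<And>k. finite (F k)"
      "\<And>k. (\<Union>x\<in>F k. ball x (1 / real (Suc k))) = (UNIV :: 'w set)"
    by metis
  define B where "B = (SIGMA k:UNIV. F k)"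
  have cB: "countable B" unfolding B_def
    by (rule countable_SIGMA[OF countableI_type countable_finite[OF F(1)]])
  define b where "b n = ball (snd (from_nat_into B n)) (1 / real (Suc (fst (from_nat_into B n))))" for n
  have "\<exists>m. \<forall>x. \<exists>j\<le>m. x \<in> b j \<and> (\<forall>y\<in>b j. dist x y < e)" if e: "e > 0" for e
  proof -
    obtain k where k: "1 / real (Suc k) < e / 2"
      using nat_approx_posE[of "e/2"] e by (metis half_gt_zero)
    \<comment> \<open>The largest position in the merged sequence that is occupied by a ball of the
      \<open>k\<close>-th cover.\<close>
    define m where "m = Max ((\<lambda>x. to_nat_on B (k, x)) ` F k)"
    have "\<exists>j\<le>m. x \<in> b j \<and> (\<forall>y\<in>b j. dist x y < e)" for x
    proof -
      obtain z where z: "z \<in> F k" "x \<in> ball z (1 / real (Suc k))" using F(2)[of k] by blast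
      have "to_nat_on B (k, z) \<le> m" unfolding m_def using F(1) z by simp
      moreover have eq: "b (to_nat_on B (k, z)) = ball z (1 / real (Suc k))"
        unfolding b_def using z(1) cB by (simp add: B_def)
      moreover have "dist x y < e" if "y \<in> ball z (1 / real (Suc k))" for y
        using that z(2) k dist_triangle[of x y z] by (simp add: dist_commute)
      ultimately show ?thesis using z(2) by auto
    qed
    then show ?thesis by blast
  qed
  moreover have "open (b k)" for k unfolding b_def by simp
  ultimately show ?thesis using that by blast
qed

text \<open>Close codes share their first digits, hence both points lie in a common small ball.
  Uniform continuity is claimed for decoding only; the code itself is a series of indicators of open
  sets and merely Borel.\<close>

lemma compact_real_code:
  assumes comp: "compact (UNIV :: 'w::metric_space set)"
  obtains enc :: "'w::metric_space \<Rightarrow> real" where "enc \<in> borel_measurable borel" "\<And>x. enc x \<in> {0..1}"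
    "\<And>e. e > 0 \<Longrightarrow> \<exists>d>0. \<forall>x y. \<bar>enc x - enc y\<bar> < d \<longrightarrow> dist x y < e"
proof -
  obtain b :: "nat \<Rightarrow> 'w set" where b: "\<And>k. open (b k)"
    "\<And>e. e > 0 \<Longrightarrow> \<exists>m. \<forall>x. \<exists>k\<le>m. x \<in> b k \<and> (\<forall>y\<in>b k. dist x y < e)"
    using compact_countable_fine_cover[OF comp] by blast
  have "ternary_tail b 0 \<in> borel_measurable borel"
  proof -
    have [measurable]: "b k \<in> sets borel" for k using b(1) by simp
    show ?thesis unfolding ternary_tail_def[abs_def] by measurable
  qed
  moreover have "ternary_tail b 0 x \<in> {0..1}" for x using ternary_tail_bounds[of b 0 x] by simp
  moreover have "\<exists>d>0. \<forall>x y. \<bar>ternary_tail b 0 x - ternary_tail b 0 y\<bar> < d \<longrightarrow> dist x y < e"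
    if "e > 0" for e
  proof -
    obtain m where m: "\<forall>x. \<exists>k\<le>m. x \<in> b k \<and> (\<forall>y\<in>b k. dist x y < e)" using b(2)[OF \<open>e > 0\<close>] by blast
    have "dist x y < e" if *: "\<bar>ternary_tail b 0 x - ternary_tail b 0 y\<bar> < 1 / 3 ^ Suc m" for x y
    proof -
      obtain k where "k \<le> m" "x \<in> b k" "\<forall>y\<in>b k. dist x y < e" using m by blast
      then show ?thesis using ternary_tail_agree[OF *, of k] by auto
    qed
    then show ?thesis by (intro exI[of _ "1 / 3 ^ Suc m"]) auto
  qed
  ultimately show ?thesis using that by blast
qed

text \<open>The closure of the graph of the inverse code is again a graph: this extends the decoding
  map to the closure of the range of the code.\<close>

lemma compact_coded_by_reals:
  assumes comp: "compact (UNIV :: 'w::metric_space set)"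
  obtains enc :: "'w::metric_space \<Rightarrow> real" and K :: "real set" and h :: "real \<Rightarrow> 'w::metric_space"
  where "enc \<in> borel_measurable borel" "\<And>x. enc x \<in> {0..1}" "\<And>x. enc x \<in> K"
    "closed K" "continuous_on K h" "\<And>x. h (enc x) = x"
proof -
  obtain enc :: "'w \<Rightarrow> real" where enc: "enc \<in> borel_measurable borel" "\<And>x. enc x \<in> {0..1}"
    "\<And>e. e > 0 \<Longrightarrow> \<exists>d>0. \<forall>x y. \<bar>enc x - enc y\<bar> < d \<longrightarrow> dist x y < e"
    using compact_real_code[OF comp] by blast
  define K where "K = closure (range enc)"
  \<comment> \<open>\<open>adh x w\<close> says that \<open>(x, w)\<close> lies in the closure of
    the graph of decoding.\<close>
  define adh where "adh x w \<longleftrightarrow> (\<forall>d>0. \<exists>w'. \<bar>enc w' - x\<bar> < d \<and> dist w' w < d)" for x w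
  define h where "h x = (SOME w. adh x w)" for x
  have h: "adh x (h x)" if "x \<in> K" for x
  proof -
    obtain s where s: "\<And>n. s n \<in> range enc" "s \<longlonglongrightarrow> x"
      using \<open>x \<in> K\<close> unfolding K_def closure_sequential by blast
    then have "\<exists>w. s n = enc w" for n :: nat by blast
    then obtain w where w: "\<And>n::nat. s n = enc (w n)" by metis
    obtain l r where r: "strict_mono r" "(w \<circ> r) \<longlonglongrightarrow> l"
      using comp[unfolded compact_eq_seq_compact_metric seq_compact_def, rule_format, of w] by blast
    have "adh x l" unfolding adh_def
    proof (intro allI impI)
      fix d :: real assume "d > 0"
      have "(s \<circ> r) \<longlonglongrightarrow> x" using s(2) r(1) by (rule LIMSEQ_subseq_LIMSEQ)
      then have "\<forall>\<^sub>F n in sequentially. dist (s (r n)) x < d"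
        using \<open>d > 0\<close> by (auto dest: tendstoD)
      moreover have "\<forall>\<^sub>F n in sequentially. dist (w (r n)) l < d"
        using r(2) \<open>d > 0\<close> by (auto dest: tendstoD)
      ultimately have "\<forall>\<^sub>F n in sequentially. dist (s (r n)) x < d \<and> dist (w (r n)) l < d"
        by eventually_elim simp
      then obtain n where "dist (s (r n)) x < d" "dist (w (r n)) l < d"
        using eventually_happens'[OF sequentially_bot] by blast
      then show "\<exists>w'. \<bar>enc w' - x\<bar> < d \<and> dist w' l < d"
        by (intro exI[of _ "w (r n)"]) (simp add: w dist_real_def)
    qed
    then show ?thesis unfolding h_def by (rule someI)
  qed
  have encK: "enc x \<in> K" for x unfolding K_def by (rule subsetD[OF closure_subset]) simp
  \<comment> \<open>Uniform continuity survives the closure. Taking \<open>x = x'\<close> also shows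
    that the adherent point is unique, which yields \<open>h (enc x) = x\<close> below.\<close>
  have uc: "\<exists>d>0. \<forall>x\<in>K. \<forall>w x' w'. adh x w \<longrightarrow> adh x' w' \<longrightarrow> \<bar>x - x'\<bar> < d \<longrightarrow> dist w w' < e"
    if "e > 0" for e
  proof -
    have "e/3 > 0" using that by simp
    obtain d where d: "d > 0" "\<And>x y. \<bar>enc x - enc y\<bar> < d \<Longrightarrow> dist x y < e/3"
      using enc(3)[OF \<open>e/3 > 0\<close>] by blast
    have "dist w w' < e" if xw: "adh x w" "adh x' w'" "\<bar>x - x'\<bar> < d/3" for x w x' w'
    proof -
      define r where "r = min (d/3) (e/3)"
      have "r > 0" unfolding r_def using d(1) \<open>e > 0\<close> by simp
      obtain u where u: "\<bar>enc u - x\<bar> < r" "dist u w < r"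
        using xw(1) \<open>r > 0\<close> unfolding adh_def by blast
      obtain v where v: "\<bar>enc v - x'\<bar> < r" "dist v w' < r"
        using xw(2) \<open>r > 0\<close> unfolding adh_def by blast
      have "r \<le> d/3" "r \<le> e/3" unfolding r_def by auto
      then have "\<bar>enc u - enc v\<bar> < d" using u(1) v(1) xw(3) by linarith
      from d(2)[OF this] show ?thesis
        using u(2) v(2) dist_triangle[of w w' u] dist_triangle[of u w' v] \<open>r \<le> e/3\<close>
        by (simp add: dist_commute)
    qed
    then show ?thesis using d(1) by (intro exI[of _ "d/3"]) auto
  qed
  have "continuous_on K h"
    unfolding continuous_on_iff
  proof (intro ballI allI impI)
    fix x and e :: real assume "x \<in> K" "e > 0"
    from uc[OF \<open>e > 0\<close>] obtain d where d: "d > 0"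
      "\<forall>x\<in>K. \<forall>w x' w'. adh x w \<longrightarrow> adh x' w' \<longrightarrow> \<bar>x - x'\<bar> < d \<longrightarrow> dist w w' < e" by blast
    then show "\<exists>d>0. \<forall>x'\<in>K. dist x' x < d \<longrightarrow> dist (h x') (h x) < e"
      using h \<open>x \<in> K\<close> by (intro exI[of _ d]) (auto simp: dist_real_def, meson)
  qed
  moreover have "h (enc x) = x" for x
  proof (rule ccontr)
    assume "h (enc x) \<noteq> x"
    then have "dist (h (enc x)) x > 0" by simp
    moreover have "adh (enc x) x" unfolding adh_def by (metis abs_zero diff_self dist_self)
    moreover have "adh (enc x) (h (enc x))" using h encK by blast
    ultimately show False using uc[of "dist (h (enc x)) x"] encK[of x] by fastforce
  qed
  moreover have "closed K" unfolding K_def by simp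
  ultimately show ?thesis using that enc encK by blast
qed

section \<open>Invariant measures as limits of orbit averages\<close>

text \<open>Closed sets form an intersection-stable generator of the Borel sets, and the indicator
  of a closed set is a bounded pointwise limit of continuous functions.\<close>

lemma prob_measure_eqI_continuous:
  fixes M N :: "'w::metric_space measure"
  assumes M: "prob_space M" "sets M = sets borel" and N: "prob_space N" "sets N = sets borel"
    and eq: "\<And>f :: 'w \<Rightarrow> real. continuous_on UNIV f \<Longrightarrow> (\<And>x. \<bar>f x\<bar> \<le> 1) \<Longrightarrow> (\<integral>x. f x \<partial>M) = (\<integral>x. f x \<partial>N)"
  shows "M = N"
proof -
  interpret M: prob_space M by fact
  interpret N: prob_space N by fact
  have closed: "emeasure M C = emeasure N C" if C: "closed C" for C
  proof (cases "C = {}")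
    case False
    \<comment> \<open>Powers of a function that equals 1 exactly on \<open>C\<close> and is smaller
      elsewhere. This needs \<open>C\<close> nonempty, since \<open>infdist\<close> to the empty set
      is 0 by convention.\<close>
    define f where "f n x = (1 / (1 + infdist x C)) ^ n" for n :: nat and x
    have pos: "1 + infdist x C > 0" for x using infdist_nonneg[of x C] by linarith
    have cont: "continuous_on UNIV (f n)" for n unfolding f_def
      by (intro continuous_intros) (metis less_irrefl pos)
    have bd: "\<bar>f n x\<bar> \<le> 1" for n x unfolding f_def
      using infdist_nonneg[of x C] by (auto simp: field_simps intro!: power_le_one)
    have lim: "(\<lambda>n. f n x) \<longlonglongrightarrow> indicator C x" for x
    proof (cases "x \<in> C")
      case True
      then show ?thesis unfolding f_def by simp
    next
      case x: False
      then have "infdist x C > 0" using C False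
        by (metis in_closed_iff_infdist_zero infdist_nonneg less_eq_real_def)
      then have "(\<lambda>n. (1 / (1 + infdist x C)) ^ n) \<longlonglongrightarrow> 0"
        by (intro LIMSEQ_realpow_zero) auto
      then show ?thesis using x unfolding f_def by simp
    qed
    have conv: "(\<lambda>n. \<integral>x. f n x \<partial>Q) \<longlonglongrightarrow> measure Q C"
      if Q: "prob_space Q" "sets Q = sets borel" for Q :: "'w measure"
    proof -
      interpret Q: prob_space Q by fact
      have [measurable]: "C \<in> sets Q" using C Q(2) by simp
      have [measurable]: "f n \<in> borel_measurable Q" for n
        using borel_measurable_continuous_onI[OF cont] Q(2) by (simp cong: measurable_cong_sets)
      have "(\<lambda>n. \<integral>x. f n x \<partial>Q) \<longlonglongrightarrow> (\<integral>x. indicator C x \<partial>Q)"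
        by (rule integral_dominated_convergence[where w = "\<lambda>_. 1"]) (use bd lim in auto)
      then show ?thesis by simp
    qed
    have "measure M C = measure N C"
      using LIMSEQ_unique[OF conv[OF M] conv[OF N, folded eq[OF cont bd]]] .
    then show ?thesis by (simp add: M.emeasure_eq_measure N.emeasure_eq_measure)
  qed simp
  have sp: "space M = UNIV" "space N = UNIV"
    using M(2) N(2) by (auto dest: sets_eq_imp_space_eq)
  show ?thesis
  proof (rule measure_eqI_generator_eq[where E = "Collect closed" and \<Omega> = UNIV and A = "\<lambda>_. UNIV"])
    show "Int_stable (Collect closed)" by (auto simp: Int_stable_def)
    show "sets M = sigma_sets UNIV (Collect closed)" "sets N = sigma_sets UNIV (Collect closed)"
      by (simp_all add: M(2) N(2) borel_eq_closed)
  qed (use closed in auto)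
qed

lemma integral_uniform_interval:
  fixes g :: "real \<Rightarrow> real"
  assumes "continuous_on UNIV g" "T > 0"
  shows "(\<integral>x. g x \<partial>uniform_measure lborel {0..T}) = integral {0..T} g / T"
proof -
  have [measurable]: "g \<in> borel_measurable borel" by (rule borel_measurable_continuous_onI) fact
  have "uniform_measure lborel {0..T} = density lborel (\<lambda>x. ennreal (indicator {0..T} x / T))"
    unfolding uniform_measure_def using assms(2)
    by (intro density_cong)
      (auto simp: divide_ennreal[of 1, simplified] indicator_def intro!: AE_I2)
  then have "(\<integral>x. g x \<partial>uniform_measure lborel {0..T})
      = (\<integral>x. (indicator {0..T} x / T) *\<^sub>R g x \<partial>lborel)"
    using assms(2) by (simp add: integral_density)
  also have "\<dots> = (\<integral>x. indicator {0..T} x *\<^sub>R g x \<partial>lborel) / T" by simp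
  also have "(\<integral>x. indicator {0..T} x *\<^sub>R g x \<partial>lborel) = integral {0..T} g"
    using set_borel_integral_eq_integral(2)[OF borel_integrable_atLeastAtMost'[of 0 T g]]
      continuous_on_subset[OF assms(1)] unfolding set_lebesgue_integral_def by auto
  finally show ?thesis .
qed

text \<open>The two integrals differ only on the windows \<open>{0..t}\<close> and
  \<open>{T..T + t}\<close>. After division by \<open>T\<close> the bound vanishes in the limit, and
  so limits of time averages are invariant.\<close>

lemma abs_integral_shift_diff_le:
  fixes g :: "real \<Rightarrow> real"
  assumes g: "continuous_on UNIV g" and B: "\<And>s. \<bar>g s\<bar> \<le> B" and "0 \<le> t" "0 \<le> T"
  shows "\<bar>integral {0..T} (\<lambda>s. g (s + t)) - integral {0..T} g\<bar> \<le> 2 * B * t"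
proof -
  have io: "g integrable_on {a..b}" for a b
    using g by (blast intro: integrable_continuous_real continuous_on_subset)
  have "integral {0..T} (\<lambda>s. g (s + t)) = integral {t..T + t} g"
    using integral_shift[of 0 t T g] continuous_on_subset[OF g] by (simp add: o_def)
  moreover have "integral {0..t} g + integral {t..T + t} g = integral {0..T + t} g"
    "integral {0..T} g + integral {T..T + t} g = integral {0..T + t} g"
    by (rule Henstock_Kurzweil_Integration.integral_combine; use assms io in auto)+
  moreover have "\<bar>integral {0..t} g\<bar> \<le> B * t" "\<bar>integral {T..T + t} g\<bar> \<le> B * t"
    using integral_bound[of 0 t g B] integral_bound[of T "T + t" g B] assms continuous_on_subset[OF g]
    by auto
  ultimately show ?thesis by (simp add: abs_le_iff)
qed

lemma flow_zero: "continuous_flow \<sigma> \<Longrightarrow> \<sigma> 0 x = x"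
  and flow_add: "continuous_flow \<sigma> \<Longrightarrow> \<sigma> (s + t) x = \<sigma> t (\<sigma> s x)"
  by (simp_all add: continuous_flow_def)

lemma flow_continuous:
  assumes "continuous_flow \<sigma>"
  shows "continuous_on UNIV (\<lambda>s. \<sigma> s x)" "continuous_on UNIV (\<sigma> t)"
proof -
  have c: "continuous_on UNIV (\<lambda>(t, x). \<sigma> t x)"
    using assms unfolding continuous_flow_def by auto
  show "continuous_on UNIV (\<lambda>s. \<sigma> s x)"
    using continuous_on_compose2[OF c, of UNIV "\<lambda>s. (s, x)"] by (simp add: continuous_on_Pair)
  show "continuous_on UNIV (\<sigma> t)"
    using continuous_on_compose2[OF c, of UNIV "\<lambda>x. (t, x)"] by (simp add: continuous_on_Pair)
qed

lemma compact_continuous_bounded: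
  fixes f :: "'w::metric_space \<Rightarrow> real"
  assumes "compact (UNIV :: 'w set)" "continuous_on UNIV f"
  obtains B where "B > 0" "\<And>x. \<bar>f x\<bar> \<le> B"
proof -
  have "bounded (range f)"
    using compact_continuous_image[OF assms(2,1)] by (rule compact_imp_bounded)
  then show ?thesis using that by (auto simp: bounded_pos)
qed

text \<open>Coding the space by a set of real numbers reduces weak compactness to Helly's theorem.\<close>

lemma invariant_weak_limit_of_orbit:
  fixes \<sigma> :: "real \<Rightarrow> 'w::metric_space \<Rightarrow> 'w"
  assumes comp: "compact (UNIV :: 'w set)" and flow: "continuous_flow \<sigma>"
    and Tpos: "\<And>n. T n > 0" and Tlim: "filterlim T at_top sequentially"
  obtains \<nu> r where "invariant_prob \<sigma> \<nu>" "strict_mono (r :: nat \<Rightarrow> nat)"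
    "\<And>f :: 'w \<Rightarrow> real. continuous_on UNIV f \<Longrightarrow>
      (\<lambda>k. integral {0..T (r k)} (\<lambda>s. f (\<sigma> s x)) / T (r k)) \<longlonglongrightarrow> (\<integral>w. f w \<partial>\<nu>)"
proof -
  obtain enc :: "'w \<Rightarrow> real" and K :: "real set" and h :: "real \<Rightarrow> 'w"
    where enc[measurable]: "enc \<in> borel_measurable borel" and enc01: "\<And>x. enc x \<in> {0..1}"
      and encK: "\<And>x. enc x \<in> K" and K: "closed K" and hc: "continuous_on K h"
      and h_enc: "\<And>x. h (enc x) = x"
    using compact_coded_by_reals[OF comp] by blast
  note [measurable] = borel_measurable_continuous_onI[OF flow_continuous(1)[OF flow]]
    borel_measurable_continuous_onI[OF flow_continuous(2)[OF flow]]
  define U where "U n = uniform_measure lborel {0..T n}" for n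
  have [simp]: "sets (U n) = sets borel" "space (U n) = UNIV" for n unfolding U_def by auto
  have U: "prob_space (U n)" for n unfolding U_def
    by (rule prob_space_uniform_measure) (use Tpos[of n] in auto)
  have meas: "(\<lambda>s. enc (\<sigma> s x)) \<in> borel_measurable (U n)" for n
    by (simp cong: measurable_cong_sets)
  \<comment> \<open>The law of the coded orbit at a time chosen uniformly from
    \<open>{0..T n}\<close>.\<close>
  define E where "E n = distr (U n) borel (\<lambda>s. enc (\<sigma> s x))" for n
  have E: "real_distribution (E n)" for n
    unfolding E_def real_distribution_def real_distribution_axioms_def
    using prob_space.prob_space_distr[OF U meas] by auto
  \<comment> \<open>All codes lie in \<open>{0..1}\<close>, so the single interval
    \<open>{-1<..1}\<close> carries the whole mass; it starts at -1 because the left end point is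
    excluded.\<close>
  have "tight E" unfolding tight_def
  proof (intro conjI allI impI)
    fix e :: real assume "e > 0"
    have "measure (E n) {-1<..1} > 1 - e" for n
    proof -
      have "measure (E n) {-1<..1} = measure (U n) ((\<lambda>s. enc (\<sigma> s x)) -` {-1<..1} \<inter> space (U n))"
        unfolding E_def by (rule measure_distr[OF meas]) auto
      also have "(\<lambda>s. enc (\<sigma> s x)) -` {-1<..1} \<inter> space (U n) = space (U n)"
        using enc01 by (force simp: less_le_trans[of "-1::real" 0])
      also have "measure (U n) (space (U n)) = 1" using U prob_space.prob_space by blast
      finally show ?thesis using \<open>e > 0\<close> by simp
    qed
    then show "\<exists>a b. a < b \<and> (\<forall>n. 1 - e < measure (E n) {a<..b})"
      by (intro exI[of _ "-1"] exI[of _ 1]) auto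
  qed (use E in auto)
  from tight_imp_convergent_subsubsequence[OF this strict_mono_id]
  obtain r M where r: "strict_mono (r :: nat \<Rightarrow> nat)" and M: "real_distribution M"
    and wc: "weak_conv_m (E \<circ> id \<circ> r) M" by blast
  interpret M: real_distribution M by fact
  have wlim: "(\<lambda>k. \<integral>s. F (enc (\<sigma> s x)) \<partial>U (r k)) \<longlonglongrightarrow> (\<integral>y. F y \<partial>M)"
    if F: "continuous_on UNIV F" "\<And>y. \<bar>F y\<bar> \<le> B" for F :: "real \<Rightarrow> real" and B
  proof -
    have [measurable]: "F \<in> borel_measurable borel" by (rule borel_measurable_continuous_onI) fact
    have "(\<lambda>k. integral\<^sup>L ((E \<circ> id \<circ> r) k) F) \<longlonglongrightarrow> integral\<^sup>L M F"
      by (rule weak_conv_imp_integral_bdd_continuous_conv[OF _ M wc])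
        (use E F in \<open>auto simp: continuous_on_eq_continuous_at\<close>)
    moreover have "integral\<^sup>L ((E \<circ> id \<circ> r) k) F = (\<integral>s. F (enc (\<sigma> s x)) \<partial>U (r k))" for k
      unfolding E_def o_def id_def by (rule integral_distr[OF meas]) simp
    ultimately show ?thesis by simp
  qed
  \<comment> \<open>A weak limit may charge points that are not codes, but not the complement of the
    closed set \<open>K\<close>: the truncated distance to \<open>K\<close> is a bounded continuous
    test function that vanishes on all codes.\<close>
  have AEK: "AE y in M. y \<in> K"
  proof -
    define F where "F y = min 1 (infdist y K)" for y
    have Fc: "continuous_on UNIV F" unfolding F_def by (intro continuous_intros)
    have [measurable]: "F \<in> borel_measurable borel" by (rule borel_measurable_continuous_onI[OF Fc])
    have F01: "0 \<le> F y" "\<bar>F y\<bar> \<le> 1" for y unfolding F_def using infdist_nonneg[of y K] by auto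
    have "F (enc w) = 0" for w unfolding F_def using encK by simp
    then have "(\<integral>y. F y \<partial>M) = 0"
      using wlim[OF Fc F01(2)] by (simp add: LIMSEQ_const_iff)
    moreover have "integrable M F"
      by (rule M.integrable_const_bound[of _ 1]) (use F01 in auto)
    ultimately have "AE y in M. F y = 0"
      using integral_nonneg_eq_0_iff_AE[of M F] F01(1) by auto
    moreover have "y \<in> K" if "F y = 0" for y
    proof -
      have "infdist y K = 0" using that unfolding F_def by (auto simp: min_def split: if_splits)
      then show ?thesis using in_closed_iff_infdist_zero[OF K] encK by blast
    qed
    ultimately show ?thesis by (auto elim: eventually_mono)
  qed
  \<comment> \<open>The value \<open>x\<close> off \<open>K\<close> is arbitrary, since that set is
    null for \<open>M\<close>.\<close>
  define h' where "h' y = (if y \<in> K then h y else x)" for y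
  have h'[measurable]: "h' \<in> borel_measurable borel"
    unfolding h'_def[abs_def] by (rule borel_measurable_continuous_on_if) (use K hc in auto)
  have h'M: "h' \<in> borel_measurable M" by measurable
  define \<nu> where "\<nu> = distr M borel h'"
  have \<nu>: "prob_space \<nu>" "sets \<nu> = sets borel"
    unfolding \<nu>_def using M.prob_space_distr[OF h'M] by auto
  have conv: "(\<lambda>k. integral {0..T (r k)} (\<lambda>s. f (\<sigma> s x)) / T (r k)) \<longlonglongrightarrow> (\<integral>w. f w \<partial>\<nu>)"
    if f: "continuous_on UNIV f" for f :: "'w \<Rightarrow> real"
  proof -
    have [measurable]: "f \<in> borel_measurable borel" by (rule borel_measurable_continuous_onI) fact
    obtain B where B: "B > 0" "\<And>x. \<bar>f x\<bar> \<le> B" by (rule compact_continuous_bounded[OF comp f]) blast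
    \<comment> \<open>Weak convergence tests functions on the whole line, whereas \<open>f\<close>
      composed with \<open>h\<close> is continuous only on \<open>K\<close>; Tietze's theorem closes
      the gap.\<close>
    have "continuous_on K (\<lambda>y. f (h y))" by (rule continuous_on_compose2[OF f hc]) auto
    then obtain F where F: "continuous_on UNIV F" "\<And>y. y \<in> K \<Longrightarrow> F y = f (h y)" "\<And>y. \<bar>F y\<bar> \<le> B"
    proof (rule Tietze[of K "\<lambda>y. f (h y)" UNIV B])
      show "closedin (top_of_set UNIV) K" "0 \<le> B" using K B by auto
    qed (use B in auto)
    have [measurable]: "F \<in> borel_measurable borel" by (rule borel_measurable_continuous_onI) fact
    have "(\<integral>w. f w \<partial>\<nu>) = (\<integral>y. f (h' y) \<partial>M)" unfolding \<nu>_def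
      by (rule integral_distr[OF h'M]) simp
    also have "\<dots> = (\<integral>y. F y \<partial>M)"
    proof (rule integral_cong_AE)
      show "AE y in M. f (h' y) = F y"
        using AEK by eventually_elim (simp add: h'_def F(2))
    qed measurable
    finally have "(\<integral>w. f w \<partial>\<nu>) = (\<integral>y. F y \<partial>M)" .
    moreover have "(\<integral>s. F (enc (\<sigma> s x)) \<partial>U n) = integral {0..T n} (\<lambda>s. f (\<sigma> s x)) / T n" for n
      unfolding F(2)[OF encK] h_enc U_def
      by (rule integral_uniform_interval[OF continuous_on_compose2[OF f flow_continuous(1)[OF flow]]])
        (use Tpos in auto)
    ultimately show ?thesis using wlim[OF F(1,3)] by simp
  qed
  \<comment> \<open>If \<open>f\<close> is a continuous test function, so is its composition with
    \<open>\<sigma> t\<close>; the time averages of the two differ by at most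
    \<open>2 * t / T (r k)\<close>.\<close>
  have inv: "distr \<nu> borel (\<sigma> t) = \<nu>" if "t \<ge> 0" for t
  proof (rule prob_measure_eqI_continuous)
    have m: "\<sigma> t \<in> borel_measurable \<nu>" using \<nu>(2) by (simp cong: measurable_cong_sets)
    show "prob_space (distr \<nu> borel (\<sigma> t))" by (rule prob_space.prob_space_distr[OF \<nu>(1) m])
    fix f :: "'w \<Rightarrow> real" assume f: "continuous_on UNIV f" and f1: "\<And>x. \<bar>f x\<bar> \<le> 1"
    have [measurable]: "f \<in> borel_measurable borel" by (rule borel_measurable_continuous_onI) fact
    have ft: "continuous_on UNIV (\<lambda>w. f (\<sigma> t w))"
      by (rule continuous_on_compose2[OF f flow_continuous(2)[OF flow]]) auto
    have fs: "continuous_on UNIV (\<lambda>s. f (\<sigma> s x))"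
      by (rule continuous_on_compose2[OF f flow_continuous(1)[OF flow]]) auto
    have "(\<lambda>k. integral {0..T (r k)} (\<lambda>s. f (\<sigma> t (\<sigma> s x))) / T (r k)
        - integral {0..T (r k)} (\<lambda>s. f (\<sigma> s x)) / T (r k)) \<longlonglongrightarrow> (\<integral>w. f (\<sigma> t w) \<partial>\<nu>) - (\<integral>w. f w \<partial>\<nu>)"
      by (intro tendsto_diff conv f ft)
    moreover have "(\<lambda>k. integral {0..T (r k)} (\<lambda>s. f (\<sigma> t (\<sigma> s x))) / T (r k)
        - integral {0..T (r k)} (\<lambda>s. f (\<sigma> s x)) / T (r k)) \<longlonglongrightarrow> 0"
    proof (rule Lim_null_comparison)
      have "\<bar>integral {0..T n} (\<lambda>s. f (\<sigma> t (\<sigma> s x))) - integral {0..T n} (\<lambda>s. f (\<sigma> s x))\<bar> \<le> 2 * t" for n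
        using abs_integral_shift_diff_le[OF fs f1 \<open>t \<ge> 0\<close>, of "T n"] Tpos[of n]
        by (simp add: flow_add[OF flow])
      then show "\<forall>\<^sub>F k in sequentially. norm (integral {0..T (r k)} (\<lambda>s. f (\<sigma> t (\<sigma> s x))) / T (r k)
        - integral {0..T (r k)} (\<lambda>s. f (\<sigma> s x)) / T (r k)) \<le> 2 * t / T (r k)"
        by (simp add: diff_divide_distrib[symmetric] abs_of_pos[OF Tpos] divide_right_mono less_imp_le[OF Tpos])
      have "filterlim (\<lambda>k. T (r k)) at_top sequentially"
        using filterlim_compose[OF Tlim filterlim_subseq[OF r]] .
      then show "(\<lambda>k. 2 * t / T (r k)) \<longlonglongrightarrow> 0"
        by (rule tendsto_divide_0[OF tendsto_const filterlim_at_top_imp_at_infinity])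
    qed
    ultimately have "(\<integral>w. f (\<sigma> t w) \<partial>\<nu>) = (\<integral>w. f w \<partial>\<nu>)"
      using LIMSEQ_unique by fastforce
    then show "(\<integral>w. f w \<partial>distr \<nu> borel (\<sigma> t)) = (\<integral>w. f w \<partial>\<nu>)"
      by (subst integral_distr[OF m]) auto
  qed (use \<nu> in auto)
  have "distr \<nu> borel (\<sigma> t) = \<nu>" for t
  proof (cases "t \<ge> 0")
    case False
    have m: "\<sigma> t \<in> borel_measurable \<nu>" "\<sigma> t \<in> borel \<rightarrow>\<^sub>M borel" "\<sigma> (-t) \<in> borel_measurable \<nu>" for t
      using \<nu>(2) by (simp_all cong: measurable_cong_sets)
    \<comment> \<open>For negative \<open>t\<close>, the known invariance under
      \<open>\<sigma> (-t)\<close> is pushed forward by \<open>\<sigma> t\<close>.\<close>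
    have "distr \<nu> borel (\<sigma> t) = distr (distr \<nu> borel (\<sigma> (-t))) borel (\<sigma> t)"
      using inv[of "-t"] False by simp
    also have "\<dots> = distr \<nu> borel (\<lambda>w. w)"
      by (subst distr_distr[OF m(2,3)])
        (simp add: o_def flow_add[OF flow, symmetric] flow_zero[OF flow])
    also have "\<dots> = \<nu>" by (rule distr_id2) (simp add: \<nu>(2))
    finally show ?thesis .
  qed (rule inv)
  then have "invariant_prob \<sigma> \<nu>" unfolding invariant_prob_def using \<nu> by auto
  then show ?thesis using that r conv by blast
qed

section \<open>Supermultiplicative growth over a minimal uniquely ergodic flow\<close>

text \<open>Density of the full orbit gives a visit at a time of unknown sign. By compactness
  finitely many times serve all points, so a search begun late enough cannot be thrown back before
  \<open>R\<close>.\<close>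

lemma minimal_flow_recurrent:
  fixes \<sigma> :: "real \<Rightarrow> 'w::metric_space \<Rightarrow> 'w"
  assumes comp: "compact (UNIV :: 'w set)" and flow: "continuous_flow \<sigma>" and minimal: "minimal_flow \<sigma>"
    and U: "open U" "U \<noteq> {}"
  shows "\<exists>t\<ge>R. \<sigma> t w \<in> U"
proof -
  have hit: "\<exists>t. \<sigma> t w \<in> U" for w
  proof -
    have "closure (range (\<lambda>t. \<sigma> t w)) = UNIV" using minimal unfolding minimal_flow_def by blast
    then have "U \<inter> range (\<lambda>t. \<sigma> t w) \<noteq> {}"
      using open_Int_closure_eq_empty[OF U(1), of "range (\<lambda>t. \<sigma> t w)"] U(2) by auto
    then show ?thesis by blast
  qed
  have "open (\<sigma> t -` U)" for t
    using flow_continuous(2)[OF flow] U(1) by (simp add: continuous_on_open_vimage)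
  moreover have "(UNIV :: 'w set) \<subseteq> (\<Union>t\<in>UNIV. \<sigma> t -` U)" using hit by auto
  ultimately obtain D where D: "finite D" "(UNIV :: 'w set) \<subseteq> (\<Union>t\<in>D. \<sigma> t -` U)"
    by (rule compactE_image[OF comp])
  \<comment> \<open>A bound for the absolute value of every time in \<open>D\<close>; the visit is
    sought from time \<open>R + L\<close> on.\<close>
  define L where "L = (\<Sum>t\<in>D. \<bar>t\<bar>)"
  obtain t where t: "t \<in> D" "\<sigma> t (\<sigma> (R + L) w) \<in> U" using D(2) by blast
  have "\<bar>t\<bar> \<le> L" unfolding L_def using member_le_sum[of t D abs] D(1) t(1) by simp
  then show ?thesis using t(2) by (intro exI[of _ "R + L + t"]) (simp add: flow_add[OF flow])
qed

text \<open>Conditioning on an invariant set of positive measure gives an invariant probability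
  again. By uniqueness it is \<open>\<mu>\<close> itself, so the set has measure 1.\<close>

lemma uniquely_ergodic_zero_one:
  assumes flow: "continuous_flow \<sigma>" and ue: "uniquely_ergodic \<sigma>" and \<mu>: "invariant_prob \<sigma> \<mu>"
    and P: "P \<in> sets borel" and inv: "\<And>t. \<sigma> t -` P = P"
  shows "measure \<mu> P = 0 \<or> measure \<mu> P = 1"
proof (rule disjCI)
  assume "measure \<mu> P \<noteq> 1"
  interpret prob_space \<mu> using \<mu> unfolding invariant_prob_def by blast
  have sets[simp, measurable_cong]: "sets \<mu> = sets borel" and di: "\<And>t. distr \<mu> borel (\<sigma> t) = \<mu>"
    using \<mu> unfolding invariant_prob_def by auto
  have sp: "space \<mu> = UNIV" using sets_eq_imp_space_eq[OF sets] by simp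
  note [measurable] = borel_measurable_continuous_onI[OF flow_continuous(2)[OF flow]] P
  show "measure \<mu> P = 0"
  proof (rule ccontr)
    assume "measure \<mu> P \<noteq> 0"
    then have P0: "emeasure \<mu> P \<noteq> 0" by (simp add: emeasure_eq_measure)
    define \<nu> where "\<nu> = uniform_measure \<mu> P"
    have \<nu>s[measurable_cong]: "sets \<nu> = sets borel" unfolding \<nu>_def by simp
    have "distr \<nu> borel (\<sigma> t) = \<nu>" for t
    proof (rule measure_eqI)
      fix X assume "X \<in> sets (distr \<nu> borel (\<sigma> t))"
      then have [measurable]: "X \<in> sets borel" by simp
      have vX: "\<sigma> t -` X \<in> sets borel" using measurable_sets[of "\<sigma> t" borel borel X] by simp
      have "emeasure (distr \<nu> borel (\<sigma> t)) X = emeasure \<nu> (\<sigma> t -` X)"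
        by (subst emeasure_distr) (simp_all add: \<nu>_def sp)
      also have "\<dots> = emeasure \<mu> (P \<inter> \<sigma> t -` X) / emeasure \<mu> P"
        unfolding \<nu>_def by (rule emeasure_uniform_measure) (use vX in auto)
      also have "P \<inter> \<sigma> t -` X = \<sigma> t -` (P \<inter> X) \<inter> space \<mu>" using inv[of t] sp by auto
      also have "emeasure \<mu> \<dots> = emeasure (distr \<mu> borel (\<sigma> t)) (P \<inter> X)"
        by (subst emeasure_distr) simp_all
      also have "\<dots> / emeasure \<mu> P = emeasure \<nu> X"
        unfolding di \<nu>_def by (rule emeasure_uniform_measure[symmetric]) auto
      finally show "emeasure (distr \<nu> borel (\<sigma> t)) X = emeasure \<nu> X" .
    qed (simp add: \<nu>s)
    moreover have "prob_space \<nu>" unfolding \<nu>_def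
      by (rule prob_space_uniform_measure) (use P0 in auto)
    ultimately have "invariant_prob \<sigma> \<nu>" using \<nu>s unfolding invariant_prob_def by auto
    then have "\<nu> = \<mu>" using ue \<mu> unfolding uniquely_ergodic_def by blast
    moreover have "measure \<nu> P = 1"
      unfolding \<nu>_def using P0 by (subst measure_uniform_measure) (auto simp: emeasure_eq_measure)
    ultimately show False using \<open>measure \<mu> P \<noteq> 1\<close> by simp
  qed
qed

text \<open>Integrating over the starting phase \<open>s\<close> turns bounds on sums along the grid
  of step \<open>T\<close> into a bound on the integral along the continuous orbit.\<close>

lemma integral_sum_of_blocks:
  fixes f :: "real \<Rightarrow> real"
  assumes f: "continuous_on UNIV f" and "0 \<le> T"
  shows "integral {0..T} (\<lambda>s. \<Sum>j<q. f (s + real j * T)) = integral {0..real q * T} f"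
proof (induction q)
  case (Suc q)
  have io: "g integrable_on {u..v}" if "continuous_on UNIV g" for g :: "real \<Rightarrow> real" and u v
    using that by (blast intro: integrable_continuous_real continuous_on_subset)
  have c: "continuous_on UNIV (\<lambda>s. f (s + c))" for c
    by (rule continuous_on_compose2[OF f]) (auto intro!: continuous_intros)
  have "integral {0..T} (\<lambda>s. \<Sum>j<Suc q. f (s + real j * T))
      = integral {0..real q * T} f + integral {0..T} (\<lambda>s. f (s + real q * T))"
    using Suc by (simp add: Henstock_Kurzweil_Integration.integral_add io[OF continuous_on_sum[OF c]] io[OF c])
  also have "integral {0..T} (\<lambda>s. f (s + real q * T)) = integral {real q * T..T + real q * T} f"
    using integral_shift[of 0 "real q * T" T f] continuous_on_subset[OF f] by (simp add: o_def)
  also have "integral {0..real q * T} f + \<dots> = integral {0..real (Suc q) * T} f"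
    using Henstock_Kurzweil_Integration.integral_combine[of 0 "real q * T" "T + real q * T" f]
      io[OF f] \<open>0 \<le> T\<close> by (simp add: algebra_simps)
  finally show ?case .
qed simp

section \<open>Supermultiplicative cocycles and the set where they diverge\<close>

locale growth_cocycle =
  fixes \<sigma> :: "real \<Rightarrow> 'w::metric_space \<Rightarrow> 'w" and G :: "real \<Rightarrow> 'w \<Rightarrow> real" and a :: real and U :: "real \<Rightarrow> real"
  assumes comp: "compact (UNIV :: 'w set)"
    and flow: "continuous_flow \<sigma>"
    and a_nonneg: "0 \<le> a"
    and G_lower: "0 \<le> t \<Longrightarrow> exp (- (a * t)) \<le> G t w"
    and G_super: "0 \<le> s \<Longrightarrow> 0 \<le> t \<Longrightarrow> G s w * G t (\<sigma> s w) \<le> G (s + t) w"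
    and G_upper: "0 \<le> s \<Longrightarrow> 0 \<le> t \<Longrightarrow> G (s + t) w \<le> U s * G t (\<sigma> s w)"
    and U_pos: "0 \<le> s \<Longrightarrow> 0 < U s"
    and G_cont: "0 \<le> t \<Longrightarrow> continuous_on UNIV (G t)"
begin

definition growing :: "'w set" where
  "growing = {w. filterlim (\<lambda>t. G t w) at_top at_top}"

definition doubled_after :: "real \<Rightarrow> 'w set" where
  "doubled_after N = {w. \<forall>t\<ge>N. 2 \<le> G t w}"

lemma G_pos: "0 \<le> t \<Longrightarrow> 0 < G t w"
  using less_le_trans[OF exp_gt_zero G_lower] .

lemma growing_iff: "w \<in> growing \<longleftrightarrow> (\<forall>k. \<exists>N\<ge>0. \<forall>t\<ge>N. k \<le> G t w)"
proof -
  have "(\<exists>N. \<forall>t\<ge>N. k \<le> G t w) \<longleftrightarrow> (\<exists>N\<ge>0. \<forall>t\<ge>N. k \<le> G t w)" for k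
    by (meson max.cobounded2 max.bounded_iff)
  then show ?thesis unfolding growing_def filterlim_at_top eventually_at_top_linorder by simp
qed

lemma closed_ge_after:
  assumes "0 \<le> N"
  shows "closed {w. \<forall>t\<ge>N. k \<le> G t w}"
proof -
  have "{w. \<forall>t\<ge>N. k \<le> G t w} = (\<Inter>t\<in>{N..}. {w. k \<le> G t w})" by auto
  also have "closed \<dots>"
    using assms by (intro closed_INT ballI closed_Collect_le continuous_on_const G_cont) auto
  finally show ?thesis .
qed

lemma closed_doubled_after: "0 \<le> N \<Longrightarrow> closed (doubled_after N)"
  unfolding doubled_after_def by (rule closed_ge_after)

lemma growing_doubled: "growing \<subseteq> (\<Union>n::nat. doubled_after (real n))"
proof
  fix w assume "w \<in> growing"
  then obtain N where "\<forall>t\<ge>N. 2 \<le> G t w" unfolding growing_iff by meson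
  then show "w \<in> (\<Union>n::nat. doubled_after (real n))"
    using real_arch_simple[of N] unfolding doubled_after_def by (auto intro: order_trans)
qed

text \<open>The two outer quantifiers can be restricted to natural numbers. The uncountable one over
  \<open>t\<close> stays inside, as an intersection of closed sets.\<close>

lemma growing_borel: "growing \<in> sets borel"
proof -
  have "w \<in> growing \<longleftrightarrow> (\<forall>k::nat. \<exists>N::nat. \<forall>t\<ge>real N. real k \<le> G t w)" for w
  proof
    assume *: "\<forall>k::nat. \<exists>N::nat. \<forall>t\<ge>real N. real k \<le> G t w"
    show "w \<in> growing" unfolding growing_iff
    proof
      fix k :: real
      obtain n :: nat where "k \<le> real n" using real_arch_simple by blast
      then show "\<exists>N\<ge>0. \<forall>t\<ge>N. k \<le> G t w" using *[rule_format, of n] by (meson of_nat_0_le_iff order_trans)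
    qed
  next
    assume *: "w \<in> growing"
    show "\<forall>k::nat. \<exists>N::nat. \<forall>t\<ge>real N. real k \<le> G t w"
    proof
      fix k :: nat
      obtain N where "\<forall>t\<ge>N. real k \<le> G t w" using * unfolding growing_iff by meson
      then show "\<exists>N::nat. \<forall>t\<ge>real N. real k \<le> G t w" using real_arch_simple[of N] by (meson order_trans)
    qed
  qed
  then have "growing = (\<Inter>k::nat. \<Union>N::nat. {w. \<forall>t\<ge>real N. real k \<le> G t w})" by auto
  also have "\<dots> \<in> sets borel"
    using closed_ge_after by (intro sets.countable_INT' sets.countable_UN' borel_closed) auto
  finally show ?thesis .
qed

text \<open>For \<open>t\<close> at least 0, \<open>G_upper\<close> carries divergence forward along
  the orbit and \<open>G_super\<close> carries it back; negative times follow by exchanging the two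
  points.\<close>

lemma growing_flow_iff: "\<sigma> t w \<in> growing \<longleftrightarrow> w \<in> growing"
proof -
  have *: "\<sigma> t w \<in> growing \<longleftrightarrow> w \<in> growing" if t: "0 \<le> t" for t w
  proof
    assume w: "w \<in> growing"
    show "\<sigma> t w \<in> growing" unfolding growing_iff
    proof
      fix k
      obtain N where N: "N \<ge> 0" "\<forall>s\<ge>N. U t * k \<le> G s w" using w unfolding growing_iff by meson
      have "k \<le> G s (\<sigma> t w)" if "s \<ge> N" for s
      proof -
        have "U t * k \<le> G (t + s) w" using N that t by simp
        also have "\<dots> \<le> U t * G s (\<sigma> t w)" using N that t by (intro G_upper) auto
        finally show ?thesis using U_pos[OF t] by simp
      qed
      then show "\<exists>N\<ge>0. \<forall>s\<ge>N. k \<le> G s (\<sigma> t w)" using N(1) by blast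
    qed
  next
    assume w: "\<sigma> t w \<in> growing"
    show "w \<in> growing" unfolding growing_iff
    proof
      fix k
      obtain N where N: "N \<ge> 0" "\<forall>s\<ge>N. k / G t w \<le> G s (\<sigma> t w)" using w unfolding growing_iff by meson
      have "k \<le> G s w" if "s \<ge> t + N" for s
      proof -
        have "k / G t w \<le> G (s - t) (\<sigma> t w)" using N that by simp
        then have "k \<le> G t w * G (s - t) (\<sigma> t w)"
          using G_pos[OF t, of w] by (simp add: pos_divide_le_eq mult.commute)
        also have "\<dots> \<le> G (t + (s - t)) w" using N that t by (intro G_super) auto
        finally show ?thesis by simp
      qed
      then show "\<exists>N\<ge>0. \<forall>s\<ge>N. k \<le> G s w" using N(1) t by (intro exI[of _ "t + N"]) auto
    qed
  qed
  show ?thesis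
  proof (cases "0 \<le> t")
    case False
    have "\<sigma> (-t) (\<sigma> t w) = w"
      using flow_zero[OF flow, of w] flow_add[OF flow, of t "-t" w] by simp
    then show ?thesis using *[of "-t" "\<sigma> t w"] False by simp
  qed (rule *)
qed

text \<open>Minimality forces returns to open sets only, hence the interior. Each return is awaited
  for at least time \<open>N\<close>, so that the stretch before it contributes a factor 2; the rest
  is the induction hypothesis at the point of return.\<close>

lemma growing_of_interior_doubled:
  assumes minimal: "minimal_flow \<sigma>" and N: "0 \<le> N" and U: "interior (doubled_after N) \<noteq> {}"
  shows "growing = UNIV"
proof -
  let ?U = "interior (doubled_after N)"
  have rec: "\<exists>t\<ge>R. \<sigma> t w \<in> ?U" for R w
    by (rule minimal_flow_recurrent[OF comp flow minimal open_interior U])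
  have grow: "\<exists>r\<ge>0. \<forall>t\<ge>r. 2 ^ k \<le> G t w" if "w \<in> ?U" for k w
    using that
  proof (induction k arbitrary: w)
    case 0
    then have "w \<in> doubled_after N" using interior_subset by blast
    then show ?case using N unfolding doubled_after_def by (intro exI[of _ N]) force
  next
    case (Suc k)
    obtain t where t: "t \<ge> N" "\<sigma> t w \<in> ?U" using rec by blast
    obtain r where r: "r \<ge> 0" "\<forall>s\<ge>r. 2 ^ k \<le> G s (\<sigma> t w)" using Suc.IH[OF t(2)] by blast
    have "2 ^ Suc k \<le> G s w" if s: "s \<ge> t + r" for s
    proof -
      have "w \<in> doubled_after N" using Suc.prems interior_subset by blast
      then have "2 \<le> G t w" using t(1) unfolding doubled_after_def by simp
      moreover have "2 ^ k \<le> G (s - t) (\<sigma> t w)" using r s by simp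
      ultimately have "2 * 2 ^ k \<le> G t w * G (s - t) (\<sigma> t w)" by (intro mult_mono) auto
      also have "\<dots> \<le> G (t + (s - t)) w" using r s t N by (intro G_super) auto
      finally show ?thesis by simp
    qed
    then show ?case using r(1) t(1) N by (intro exI[of _ "t + r"]) auto
  qed
  have U_growing: "w \<in> growing" if "w \<in> ?U" for w
    unfolding growing_iff
  proof
    fix k :: real
    obtain n where n: "k < 2 ^ n" using real_arch_pow[of 2 k] by auto
    obtain r where "r \<ge> 0" "\<forall>t\<ge>r. 2 ^ n \<le> G t w" using grow[OF \<open>w \<in> ?U\<close>] by blast
    then show "\<exists>N\<ge>0. \<forall>t\<ge>N. k \<le> G t w" using n by (intro exI[of _ r]) force
  qed
  have "w \<in> growing" for w
    using rec[of 0 w] U_growing growing_flow_iff by blast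
  then show ?thesis by blast
qed

text \<open>\<open>first_category\<close> asks for an exact union, hence the intersections with
  \<open>growing\<close>. Their closures stay in the closed sets \<open>doubled_after n\<close>,
  whose interiors are empty.\<close>

lemma growing_first_category:
  assumes "minimal_flow \<sigma>" "growing \<noteq> UNIV"
  shows "first_category growing"
  unfolding first_category_def
proof (intro exI[of _ "\<lambda>n. growing \<inter> doubled_after (real n)"] conjI allI)
  fix n :: nat
  have "closure (growing \<inter> doubled_after (real n)) \<subseteq> doubled_after (real n)"
    by (rule closure_minimal) (use closed_doubled_after in auto)
  then show "interior (closure (growing \<inter> doubled_after (real n))) = {}"
    using growing_of_interior_doubled[OF assms(1), of "real n"] assms(2) interior_mono[of _ "doubled_after (real n)"]
    by auto
qed (use growing_doubled in auto)

section \<open>Mean logarithmic growth with respect to the invariant measure\<close>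

lemma ln_G_super: "0 \<le> s \<Longrightarrow> 0 \<le> t \<Longrightarrow> ln (G s w) + ln (G t (\<sigma> s w)) \<le> ln (G (s + t) w)"
  using G_super[of s t w] G_pos[of s w] G_pos[of t "\<sigma> s w"] G_pos[of "s + t" w]
  by (simp add: ln_mult_pos[symmetric] ln_le_cancel_iff[THEN iffD2])

lemma ln_G_lower: "0 \<le> t \<Longrightarrow> - (a * t) \<le> ln (G t w)"
  using G_lower[of t w] G_pos[of t w] by (simp add: ln_ge_iff)

lemma ln_G_cont: "0 \<le> t \<Longrightarrow> continuous_on UNIV (\<lambda>w. ln (G t w))"
  by (intro continuous_intros G_cont) (metis G_pos less_irrefl)+

lemma sum_ln_G_le:
  assumes "0 \<le> T"
  shows "(\<Sum>j<q. ln (G T (\<sigma> (real j * T) w))) \<le> ln (G (real q * T) w)"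
proof (induction q)
  case 0
  then show ?case using ln_G_lower[of 0 w] by simp
next
  case (Suc q)
  then show ?case using ln_G_super[of "real q * T" T w] \<open>0 \<le> T\<close> by (simp add: algebra_simps)
qed

text \<open>The growth factor at least doubles from one visit of \<open>doubled_after N\<close> to the next one.\<close>

lemma visits_le_ln_G:
  fixes N k :: nat
  assumes w: "w \<in> doubled_after (real N)"
  shows "ln 2 * (\<Sum>j<k. indicator (doubled_after (real N)) (\<sigma> (real j * real N) w)) \<le> ln (G (real k * real N) w)"
proof (cases k)
  case 0
  then show ?thesis using ln_G_lower[of 0 w] by simp
next
  case (Suc n)
  let ?C = "doubled_after (real N)"
  let ?v = "\<lambda>k. \<Sum>j<k. indicator ?C (\<sigma> (real j * real N) w) :: real"
  \<comment> \<open>Distinct grid times are at least \<open>N\<close> apart, so a visit at index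
    \<open>j\<close> gains a factor 2 by any later index \<open>m\<close>.\<close>
  have step: "ln (G (real j * real N) w) + ln 2 \<le> ln (G (real m * real N) w)"
    if "\<sigma> (real j * real N) w \<in> ?C" "j < m" for j m :: nat
  proof -
    have "real N * 1 \<le> real N * (real m - real j)" using that(2) by (intro mult_left_mono) auto
    then have le: "real N \<le> real m * real N - real j * real N" by (simp add: algebra_simps)
    then have "2 \<le> G (real m * real N - real j * real N) (\<sigma> (real j * real N) w)"
      using that(1) unfolding doubled_after_def by blast
    then have "ln 2 \<le> ln (G (real m * real N - real j * real N) (\<sigma> (real j * real N) w))" by simp
    then show ?thesis
      using ln_G_super[of "real j * real N" "real m * real N - real j * real N" w] le by simp
  qed
  \<comment> \<open>Here \<open>j\<close> is the last visit so far. Its own gain is still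
    outstanding, hence the \<open>- 1\<close>; the missing \<open>ln 2\<close> is collected at the
    end on the stretch from \<open>j\<close> to \<open>k\<close>.\<close>
  have "\<exists>j\<le>n. \<sigma> (real j * real N) w \<in> ?C \<and> ln 2 * (?v (Suc n) - 1) \<le> ln (G (real j * real N) w)" for n
  proof (induction n)
    case 0
    show ?case using w ln_G_lower[of 0 w] by (simp add: flow_zero[OF flow])
  next
    case (Suc n)
    then obtain j where j: "j \<le> n" "\<sigma> (real j * real N) w \<in> ?C"
      "ln 2 * (?v (Suc n) - 1) \<le> ln (G (real j * real N) w)" by blast
    show ?case
    proof (cases "\<sigma> (real (Suc n) * real N) w \<in> ?C")
      case True
      then have "?v (Suc (Suc n)) = ?v (Suc n) + 1" by simp
      then have "ln 2 * (?v (Suc (Suc n)) - 1) = ln 2 * (?v (Suc n) - 1) + ln 2" by (simp add: algebra_simps)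
      also have "\<dots> \<le> ln (G (real (Suc n) * real N) w)" using step[OF j(2), of "Suc n"] j by linarith
      finally show ?thesis using True by blast
    next
      case False
      then have "?v (Suc (Suc n)) = ?v (Suc n)" by simp
      then show ?thesis using j by (intro exI[of _ j]) auto
    qed
  qed
  then obtain j where j: "j \<le> n" "\<sigma> (real j * real N) w \<in> ?C"
      "ln 2 * (?v (Suc n) - 1) \<le> ln (G (real j * real N) w)" by blast
  then show ?thesis using step[OF j(2), of k] Suc by (simp add: algebra_simps)
qed

text \<open>The mean growth per block is at least the expected gain from visits minus the mean
  negative part. The gain is at least \<open>ln 2 / 2\<close> for every number of blocks, and the
  negative part becomes negligible because \<open>G\<close> diverges almost everywhere.\<close>

lemma mean_ln_G_pos:
  assumes \<mu>: "invariant_prob \<sigma> \<mu>" and full: "measure \<mu> growing = 1"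
  shows "\<exists>T>0. 0 < (\<integral>w. ln (G T w) \<partial>\<mu>)"
proof -
  interpret prob_space \<mu> using \<mu> unfolding invariant_prob_def by blast
  have sets[simp, measurable_cong]: "sets \<mu> = sets borel" and di: "\<And>t. distr \<mu> borel (\<sigma> t) = \<mu>"
    using \<mu> unfolding invariant_prob_def by auto
  have sp: "space \<mu> = UNIV" using sets_eq_imp_space_eq[OF sets] by simp
  note [measurable] = borel_measurable_continuous_onI[OF flow_continuous(2)[OF flow]] growing_borel
  have D[measurable]: "doubled_after (real n) \<in> sets borel" for n using closed_doubled_after by simp
  have "\<exists>n. 3/4 < measure \<mu> (doubled_after (real n))"
  proof -
    have "incseq (\<lambda>n::nat. doubled_after (real n))"
      by (auto simp: incseq_def doubled_after_def)
    then have "(\<lambda>n. measure \<mu> (doubled_after (real n))) \<longlonglongrightarrow> measure \<mu> (\<Union>n. doubled_after (real n))"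
      by (intro finite_Lim_measure_incseq) auto
    moreover have "measure \<mu> (\<Union>n. doubled_after (real n)) = 1"
      using finite_measure_mono[OF growing_doubled] full prob_le_1 D by (auto intro!: antisym)
    ultimately have "\<forall>\<^sub>F n in sequentially. 3/4 < measure \<mu> (doubled_after (real n))"
      by (intro order_tendstoD(1)) auto
    then show ?thesis by (auto dest: eventually_happens)
  qed
  then obtain n where n: "3/4 < measure \<mu> (doubled_after (real n))" by blast
  \<comment> \<open>The successor keeps the block length positive; the sets
    \<open>doubled_after\<close> increase, so the measure stays above 3/4.\<close>
  define N where "N = Suc n"
  define C where "C = doubled_after (real N)"
  have C[measurable]: "C \<in> sets borel" unfolding C_def by (rule D)
  have "measure \<mu> (doubled_after (real n)) \<le> measure \<mu> C" unfolding C_def N_def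
    by (rule finite_measure_mono) (use D[of "Suc n"] in \<open>auto simp: doubled_after_def simp del: of_nat_Suc\<close>)
  then have C34: "3/4 < measure \<mu> C" using n by simp
  \<comment> \<open>Logarithmic growth per block of length \<open>N\<close>. For
    \<open>k = 0\<close> division by zero makes it 0.\<close>
  define h where "h k w = ln (G (real k * real N) w) / real k" for k :: nat and w
  define neg where "neg k w = max 0 (- h (Suc k) w)" for k w
  have hc: "continuous_on UNIV (h k)" for k
    unfolding h_def by (cases "k = 0") (auto intro!: continuous_intros ln_G_cont)
  have [measurable]: "h k \<in> borel_measurable borel" for k by (rule borel_measurable_continuous_onI[OF hc])
  have ih: "integrable \<mu> (h k)" for k
  proof -
    obtain B where "\<And>w. \<bar>h k w\<bar> \<le> B" using compact_continuous_bounded[OF comp hc[of k]] by blast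
    then show ?thesis by (intro integrable_const_bound[of _ B]) auto
  qed
  have h_lower: "- (a * real N) \<le> h (Suc k) w" for k w
  proof -
    have "- (a * real N) = - (a * (real (Suc k) * real N)) / real (Suc k)" by (simp add: field_simps)
    also have "\<dots> \<le> h (Suc k) w" unfolding h_def by (intro divide_right_mono ln_G_lower) auto
    finally show ?thesis .
  qed
  have neg_bound: "norm (neg k w) \<le> a * real N" for k w
    using h_lower[of k w] a_nonneg unfolding neg_def by auto
  have [measurable]: "neg k \<in> borel_measurable borel" for k unfolding neg_def[abs_def] by measurable
  have ineg: "integrable \<mu> (neg k)" for k
    by (intro integrable_const_bound[of _ "a * real N"]) (use neg_bound in auto)
  have "AE w in \<mu>. w \<in> growing"
    using full by (intro AE_in_set_eq_1[THEN iffD2]) auto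
  then have "AE w in \<mu>. (\<lambda>k. neg k w) \<longlonglongrightarrow> 0"
  proof eventually_elim
    case (elim w)
    then obtain r where r: "r \<ge> 0" "\<forall>t\<ge>r. 1 \<le> G t w" unfolding growing_iff by blast
    obtain m :: nat where m: "r \<le> real m" using real_arch_simple by blast
    have "neg k w = 0" if "k \<ge> m" for k
    proof -
      have "real (Suc k) * 1 \<le> real (Suc k) * real N" unfolding N_def by (intro mult_left_mono) auto
      then have "real (Suc k) \<le> real (Suc k) * real N" by (simp only: mult_1_right)
      moreover have "real m \<le> real (Suc k)" using that by simp
      ultimately have "r \<le> real (Suc k) * real N" using m by (meson order_trans)
      then have "0 \<le> h (Suc k) w" unfolding h_def using r by (auto intro!: divide_nonneg_nonneg ln_ge_zero)
      then show ?thesis unfolding neg_def by simp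
    qed
    then have "\<forall>\<^sub>F k in sequentially. neg k w = 0" unfolding eventually_sequentially by blast
    then show ?case by (rule tendsto_eventually)
  qed
  then have "(\<lambda>k. \<integral>w. neg k w \<partial>\<mu>) \<longlonglongrightarrow> (\<integral>w. 0 \<partial>\<mu>)"
    by (intro integral_dominated_convergence[where w = "\<lambda>_. a * real N"]) (use neg_bound in auto)
  \<comment> \<open>The threshold is the gain from visits: at least half of \<open>Suc k\<close>
    visits on average, each worth \<open>ln 2 / Suc k\<close>.\<close>
  then have "\<forall>\<^sub>F k in sequentially. (\<integral>w. neg k w \<partial>\<mu>) < ln 2 / 2"
    by (intro order_tendstoD(2)) auto
  then obtain k where k: "(\<integral>w. neg k w \<partial>\<mu>) < ln 2 / 2" by (auto dest: eventually_happens)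
  \<comment> \<open>Visits are counted only for starting points in \<open>C\<close>, as
    \<open>visits_le_ln_G\<close> requires; elsewhere the count is 0 and \<open>- neg\<close> alone
    is a lower bound.\<close>
  define v where "v w = (\<Sum>j<Suc k. indicator (C \<inter> \<sigma> (real j * real N) -` C) w :: real)" for w
  have vC: "C \<inter> \<sigma> t -` C \<in> sets borel" for t
    using measurable_sets[of "\<sigma> t" borel borel C] by auto
  have iv: "integrable \<mu> v" unfolding v_def
    using vC by (intro Bochner_Integration.integrable_sum integrable_real_indicator) (auto simp: emeasure_eq_measure)
  have "ln 2 / real (Suc k) * v w - neg k w \<le> h (Suc k) w" for w
  proof (cases "w \<in> C")
    case True
    then have "v w = (\<Sum>j<Suc k. indicator C (\<sigma> (real j * real N) w))"
      unfolding v_def by (intro sum.cong) (auto simp: indicator_def)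
    then have "ln 2 * v w \<le> ln (G (real (Suc k) * real N) w)"
      using visits_le_ln_G[of w N "Suc k"] True unfolding C_def by simp
    then have "ln 2 * v w / real (Suc k) \<le> h (Suc k) w"
      unfolding h_def by (intro divide_right_mono) auto
    then show ?thesis unfolding neg_def by simp
  next
    case False
    then have "v w = 0" unfolding v_def by (intro sum.neutral) auto
    then show ?thesis unfolding neg_def by simp
  qed
  then have "(\<integral>w. ln 2 / real (Suc k) * v w - neg k w \<partial>\<mu>) \<le> (\<integral>w. h (Suc k) w \<partial>\<mu>)"
    using iv ineg ih by (intro integral_mono) auto
  moreover have "(\<integral>w. ln 2 / real (Suc k) * v w - neg k w \<partial>\<mu>)
      = ln 2 / real (Suc k) * (\<integral>w. v w \<partial>\<mu>) - (\<integral>w. neg k w \<partial>\<mu>)"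
    using iv ineg by simp
  moreover have "real (Suc k) / 2 \<le> (\<integral>w. v w \<partial>\<mu>)"
  proof -
    have half: "1/2 \<le> measure \<mu> (C \<inter> \<sigma> t -` C)" for t
    proof -
      have "measure \<mu> (\<sigma> t -` C) = measure (distr \<mu> borel (\<sigma> t)) C"
        by (subst measure_distr) (auto simp: sp)
      then have 1: "measure \<mu> (\<sigma> t -` C) = measure \<mu> C" by (simp add: di)
      have vs: "\<sigma> t -` C \<in> sets \<mu>" using measurable_sets[of "\<sigma> t" borel borel C] by simp
      have "measure \<mu> (C \<union> \<sigma> t -` C) = measure \<mu> C + measure \<mu> (\<sigma> t -` C) - measure \<mu> (C \<inter> \<sigma> t -` C)"
        using measure_Un3[of C \<mu> "\<sigma> t -` C"] vs C by (simp add: fmeasurable_eq_sets)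
      then show ?thesis using 1 C34 prob_le_1[of "C \<union> \<sigma> t -` C"] by linarith
    qed
    have "real (Suc k) / 2 = (\<Sum>j<Suc k. 1/2)" by simp
    also have "\<dots> \<le> (\<Sum>j<Suc k. measure \<mu> (C \<inter> \<sigma> (real j * real N) -` C))"
      by (intro sum_mono half)
    also have "\<dots> = (\<integral>w. v w \<partial>\<mu>)" unfolding v_def
      using vC by (subst Bochner_Integration.integral_sum) (auto intro!: integrable_real_indicator simp: emeasure_eq_measure)
    finally show ?thesis .
  qed
  then have "ln 2 / real (Suc k) * (real (Suc k) / 2) \<le> ln 2 / real (Suc k) * (\<integral>w. v w \<partial>\<mu>)"
    by (intro mult_left_mono) auto
  then have "ln 2 / 2 \<le> ln 2 / real (Suc k) * (\<integral>w. v w \<partial>\<mu>)" by simp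
  ultimately have "0 < (\<integral>w. h (Suc k) w \<partial>\<mu>)" using k by linarith
  then have "0 < (\<integral>w. ln (G (real (Suc k) * real N) w) \<partial>\<mu>)"
    unfolding h_def by (simp add: zero_less_divide_iff)
  then show ?thesis by (intro exI[of _ "real (Suc k) * real N"]) (simp add: N_def)
qed

text \<open>On an orbit that does not grow, \<open>G\<close> drops below a fixed \<open>K\<close> at
  arbitrarily late times. Up to those times the integral of \<open>ln (G T)\<close> stays below a
  constant, so its averages have a limit at most 0.\<close>

lemma growing_of_mean_ln_G_pos:
  assumes ue: "uniquely_ergodic \<sigma>" and \<mu>: "invariant_prob \<sigma> \<mu>"
    and T: "T > 0" and mean: "0 < (\<integral>w. ln (G T w) \<partial>\<mu>)"
  shows "w \<in> growing"
proof (rule ccontr)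
  assume w: "w \<notin> growing"
  define g where "g v = ln (G T v)" for v
  have gc: "continuous_on UNIV g" unfolding g_def using ln_G_cont T by simp
  have gs: "continuous_on UNIV (\<lambda>s. g (\<sigma> s w))"
    by (rule continuous_on_compose2[OF gc flow_continuous(1)[OF flow]]) auto
  obtain K where K: "\<And>N. N \<ge> 0 \<Longrightarrow> \<exists>t\<ge>N. G t w < K"
    using w unfolding growing_iff by (meson not_le)
  \<comment> \<open>For each phase \<open>s\<close> in \<open>{0..T}\<close> the block sum is at
    most \<open>ln K + 3 * a * T\<close>: the initial piece has length at most \<open>T\<close>, the
    final one at most \<open>2 * T\<close>, and each costs at most \<open>a\<close> per unit of
    time. Integration over \<open>s\<close> gives the factor \<open>T\<close>.\<close>
  define c where "c = T * (ln K + 3 * a * T)"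
  have "\<exists>q::nat. q \<ge> m \<and> integral {0..real q * T} (\<lambda>s. g (\<sigma> s w)) \<le> c" for m :: nat
  proof -
    obtain t where t: "t \<ge> real (Suc m) * T" "G t w < K" using K[of "real (Suc m) * T"] T by auto
    have t0: "t \<ge> 0" using t(1) T by (meson less_imp_le mult_nonneg_nonneg of_nat_0_le_iff order_trans)
    \<comment> \<open>One full block is given up, so that \<open>s + q * T\<close> does not exceed
      \<open>t\<close> for any phase \<open>s\<close>.\<close>
    define q where "q = nat \<lfloor>t / T\<rfloor> - 1"
    have "real (Suc m) \<le> t / T" using t(1) T by (simp add: pos_le_divide_eq)
    then have "Suc m \<le> nat \<lfloor>t / T\<rfloor>" by (simp add: le_nat_iff le_floor_iff)
    then have q: "m \<le> q" "real q + 1 = real (nat \<lfloor>t / T\<rfloor>)" unfolding q_def by auto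
    have "real (nat \<lfloor>t / T\<rfloor>) \<le> t / T" "t / T \<le> real (nat \<lfloor>t / T\<rfloor>) + 1"
      using t0 T by (simp, linarith)
    then have "real q + 1 \<le> t / T" "t / T \<le> real q + 2" using q(2) by linarith+
    then have qt: "real q * T + T \<le> t" "t \<le> real q * T + 2 * T"
      using T by (simp_all add: pos_le_divide_eq pos_divide_le_eq algebra_simps)
    have bound: "(\<Sum>j<q. g (\<sigma> (s + real j * T) w)) \<le> ln K + 3 * a * T" if s: "0 \<le> s" "s \<le> T" for s
    proof -
      define u where "u = t - s - real q * T"
      have u: "0 \<le> u" "u \<le> 2 * T" unfolding u_def using qt s by auto
      have "(\<Sum>j<q. g (\<sigma> (s + real j * T) w)) \<le> ln (G (real q * T) (\<sigma> s w))"
        using sum_ln_G_le[of T "\<sigma> s w" q] T unfolding g_def by (simp add: flow_add[OF flow])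
      moreover have "ln (G s w) + ln (G (real q * T) (\<sigma> s w)) \<le> ln (G (s + real q * T) w)"
        using s T by (intro ln_G_super) auto
      moreover have "ln (G (s + real q * T) w) + ln (G u (\<sigma> (s + real q * T) w)) \<le> ln (G t w)"
        using ln_G_super[of "s + real q * T" u w] s T u by (simp add: u_def)
      moreover have "- (a * T) \<le> ln (G s w)"
        using ln_G_lower[of s w] mult_left_mono[OF s(2) a_nonneg] s by linarith
      moreover have "- (2 * a * T) \<le> ln (G u (\<sigma> (s + real q * T) w))"
        using ln_G_lower[OF u(1), of "\<sigma> (s + real q * T) w"] mult_left_mono[OF u(2) a_nonneg] by linarith
      moreover have "ln (G t w) \<le> ln K" using t(2) G_pos[OF t0, of w] by simp
      ultimately show ?thesis by linarith
    qed
    have "integral {0..real q * T} (\<lambda>s. g (\<sigma> s w)) = integral {0..T} (\<lambda>s. \<Sum>j<q. g (\<sigma> (s + real j * T) w))"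
      using integral_sum_of_blocks[OF gs, of T q] T by simp
    also have "\<dots> \<le> integral {0..T} (\<lambda>s. ln K + 3 * a * T)"
    proof (rule integral_le)
      have "continuous_on {0..T} (\<lambda>s. \<Sum>j<q. g (\<sigma> (s + real j * T) w))"
        by (intro continuous_on_sum continuous_on_compose2[OF gs]) (auto intro!: continuous_intros)
      then show "(\<lambda>s. \<Sum>j<q. g (\<sigma> (s + real j * T) w)) integrable_on {0..T}"
        by (rule integrable_continuous_real)
    qed (use bound in auto)
    also have "\<dots> = c" unfolding c_def using T by simp
    finally show ?thesis using q(1) by blast
  qed
  then obtain Q where Q: "\<And>m::nat. Q m \<ge> m" "\<And>m. integral {0..real (Q m) * T} (\<lambda>s. g (\<sigma> s w)) \<le> c"
    by metis
  \<comment> \<open>The index \<open>Suc m\<close> makes every averaging time positive.\<close>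
  define \<tau> where "\<tau> m = real (Q (Suc m)) * T" for m
  have \<tau>: "\<tau> m > 0" for m unfolding \<tau>_def using Q(1)[of "Suc m"] T by simp
  have \<tau>lim: "filterlim \<tau> at_top sequentially"
  proof (rule filterlim_at_top_mono)
    show "filterlim (\<lambda>m. real m * T) at_top sequentially"
      using T filterlim_real_sequentially by (simp add: filterlim_at_top_mult_tendsto_pos[OF tendsto_const])
    have "real m \<le> real (Q (Suc m))" for m using Q(1)[of "Suc m"] by simp
    then show "\<forall>\<^sub>F m in sequentially. real m * T \<le> \<tau> m"
      unfolding \<tau>_def using T by (auto intro!: always_eventually mult_right_mono)
  qed
  obtain \<nu> r where \<nu>: "invariant_prob \<sigma> \<nu>" and r: "strict_mono (r :: nat \<Rightarrow> nat)"
    and lim: "\<And>f :: 'w \<Rightarrow> real. continuous_on UNIV f \<Longrightarrow>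
      (\<lambda>k. integral {0..\<tau> (r k)} (\<lambda>s. f (\<sigma> s w)) / \<tau> (r k)) \<longlonglongrightarrow> (\<integral>v. f v \<partial>\<nu>)"
    using invariant_weak_limit_of_orbit[OF comp flow \<tau> \<tau>lim, of w] by blast
  have "\<nu> = \<mu>" using ue \<mu> \<nu> unfolding uniquely_ergodic_def by blast
  have "(\<integral>v. g v \<partial>\<nu>) \<le> 0"
  proof (rule LIMSEQ_le[OF lim[OF gc]])
    have "filterlim (\<lambda>k. \<tau> (r k)) at_top sequentially"
      using filterlim_compose[OF \<tau>lim filterlim_subseq[OF r]] .
    then show "(\<lambda>k. c / \<tau> (r k)) \<longlonglongrightarrow> 0"
      by (rule tendsto_divide_0[OF tendsto_const filterlim_at_top_imp_at_infinity])
    show "\<exists>N. \<forall>n\<ge>N. integral {0..\<tau> (r n)} (\<lambda>s. g (\<sigma> s w)) / \<tau> (r n) \<le> c / \<tau> (r n)"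
      using Q(2) T unfolding \<tau>_def by (intro exI[of _ 0] allI impI divide_right_mono) auto
  qed
  then show False using mean \<open>\<nu> = \<mu>\<close> unfolding g_def by simp
qed

theorem growing_null:
  assumes "uniquely_ergodic \<sigma>" "invariant_prob \<sigma> \<mu>" "growing \<noteq> UNIV"
  shows "measure \<mu> growing = 0"
proof -
  have "\<sigma> t -` growing = growing" for t using growing_flow_iff by auto
  from uniquely_ergodic_zero_one[OF flow assms(1,2) growing_borel this]
  show ?thesis
    using mean_ln_G_pos[OF assms(2)] growing_of_mean_ln_G_pos[OF assms(1,2)] assms(3) by blast
qed

end

section \<open>Linear cooperative delay equations\<close>

lemma matrix_vector_component: "(M *v x) $ i = (\<Sum>j\<in>UNIV. M $ i $ j * x $ j)"
  by (simp add: matrix_vector_mult_def)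

lemma continuous_on_matrix_vector_mult:
  fixes M :: "'a::topological_space \<Rightarrow> real^'n^'m"
  assumes "continuous_on S M" "continuous_on S x"
  shows "continuous_on S (\<lambda>s. M s *v x s)"
  unfolding matrix_vector_mult_def by (intro continuous_intros assms)

lemma norm_matrix_vector_le:
  fixes M :: "real^'n^'n"
  assumes "\<And>i j. \<bar>M $ i $ j\<bar> \<le> c"
  shows "norm (M *v x) \<le> (real CARD('n) * real CARD('n) * c) * norm x"
  using onorm[OF matrix_vector_mul_bounded_linear, of M x] onorm_le_matrix_component[OF assms]
  by (meson mult_right_mono norm_ge_zero order_trans)

lemma abs_matrix_vector_component_le:
  fixes M :: "real^'n^'n"
  assumes "\<And>i j. \<bar>M $ i $ j\<bar> \<le> c" "\<And>j. \<bar>x $ j\<bar> \<le> r"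
  shows "\<bar>(M *v x) $ i\<bar> \<le> real CARD('n) * c * r"
proof -
  have "\<bar>(M *v x) $ i\<bar> \<le> (\<Sum>j\<in>UNIV. \<bar>M $ i $ j\<bar> * \<bar>x $ j\<bar>)"
    unfolding matrix_vector_component by (rule order_trans[OF sum_abs]) (simp add: abs_mult)
  also have "\<dots> \<le> (\<Sum>j\<in>(UNIV :: 'n set). c * r)"
    by (intro sum_mono mult_mono assms) (use assms(1)[of i] in \<open>auto intro: order_trans[OF abs_ge_zero]\<close>)
  finally show ?thesis by simp
qed

lemma integral_from_zero_vector_derivative:
  fixes F :: "real \<Rightarrow> 'a::banach"
  assumes F: "continuous_on UNIV F" and t: "0 \<le> t"
  shows "((\<lambda>u. integral {0..u} F) has_vector_derivative F t) (at t within {0..})"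
proof -
  have "((\<lambda>u. integral {0..u} F) has_vector_derivative F t) (at t within {0..t + 1})"
    by (rule integral_has_vector_derivative) (use continuous_on_subset[OF F] t in auto)
  also have "at t within {0..t + 1} = at t within {0..}"
    by (rule at_within_nhd[of _ "{..<t + 1}"]) auto
  finally show ?thesis .
qed

text \<open>The initial map is left out, so that the notion is stable under linear combinations and
  time shifts.\<close>

definition lin_dde :: "(real \<Rightarrow> real^'n^'n) \<Rightarrow> (real \<Rightarrow> real^'n^'n) \<Rightarrow> (real \<Rightarrow> real^'n) \<Rightarrow> bool" where
  "lin_dde \<alpha> \<beta> y \<longleftrightarrow> continuous_on {-1..} y \<and>
     (\<forall>t\<ge>0. (y has_vector_derivative (\<alpha> t *v y t + \<beta> t *v y (t - 1))) (at t within {0..}))"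

lemma lin_dde_combination:
  assumes "lin_dde \<alpha> \<beta> y" "lin_dde \<alpha> \<beta> z"
  shows "lin_dde \<alpha> \<beta> (\<lambda>t. p *\<^sub>R y t + q *\<^sub>R z t)"
  unfolding lin_dde_def
proof (intro conjI allI impI)
  show "continuous_on {-1..} (\<lambda>t. p *\<^sub>R y t + q *\<^sub>R z t)"
    using assms unfolding lin_dde_def by (intro continuous_intros) auto
  fix t :: real assume t: "0 \<le> t"
  have "((\<lambda>t. p *\<^sub>R y t + q *\<^sub>R z t) has_vector_derivative
      p *\<^sub>R (\<alpha> t *v y t + \<beta> t *v y (t - 1)) + q *\<^sub>R (\<alpha> t *v z t + \<beta> t *v z (t - 1))) (at t within {0..})"
    using assms t unfolding lin_dde_def
    by (intro has_vector_derivative_add bounded_linear.has_vector_derivative[OF bounded_linear_scaleR_right]) auto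
  then show "((\<lambda>t. p *\<^sub>R y t + q *\<^sub>R z t) has_vector_derivative
      \<alpha> t *v (p *\<^sub>R y t + q *\<^sub>R z t) + \<beta> t *v (p *\<^sub>R y (t - 1) + q *\<^sub>R z (t - 1))) (at t within {0..})"
    by (simp add: matrix_vector_right_distrib matrix_vector_mult_scaleR algebra_simps)
qed

lemma lin_dde_shift:
  assumes "lin_dde \<alpha> \<beta> y" "0 \<le> T"
  shows "lin_dde (\<lambda>t. \<alpha> (T + t)) (\<lambda>t. \<beta> (T + t)) (\<lambda>t. y (T + t))"
  unfolding lin_dde_def
proof (intro conjI allI impI)
  have "continuous_on {-1..} y" using assms unfolding lin_dde_def by blast
  then show "continuous_on {-1..} (\<lambda>t. y (T + t))"
    by (rule continuous_on_compose2) (use assms(2) in \<open>auto intro!: continuous_intros\<close>)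
  fix t :: real assume t: "0 \<le> t"
  have "(y has_vector_derivative (\<alpha> (T + t) *v y (T + t) + \<beta> (T + t) *v y (T + t - 1))) (at (T + t) within {0..})"
    using assms t unfolding lin_dde_def by auto
  then have "(y has_vector_derivative (\<alpha> (T + t) *v y (T + t) + \<beta> (T + t) *v y (T + t - 1)))
      (at (T + t) within (\<lambda>t. T + t) ` {0..})"
    by (rule has_vector_derivative_within_subset) (use assms(2) in auto)
  moreover have "((\<lambda>t. T + t) has_vector_derivative 1) (at t within {0..})"
    by (auto intro!: derivative_eq_intros)
  ultimately have "(y \<circ> (\<lambda>t. T + t) has_vector_derivative
      1 *\<^sub>R (\<alpha> (T + t) *v y (T + t) + \<beta> (T + t) *v y (T + t - 1))) (at t within {0..})"
    by (intro vector_diff_chain_within)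
  then show "((\<lambda>t. y (T + t)) has_vector_derivative
      \<alpha> (T + t) *v y (T + t) + \<beta> (T + t) *v y (T + (t - 1))) (at t within {0..})"
    by (simp add: o_def algebra_simps)
qed

text \<open>Picard's operator is a contraction for the exponentially weighted supremum norm, so the
  global solution is obtained in one step.\<close>

lemma lin_dde_exists:
  fixes \<alpha> \<beta> :: "real \<Rightarrow> real^'n^'n" and \<phi> :: "real \<Rightarrow> real^'n"
  assumes cont: "continuous_on UNIV \<alpha>" "continuous_on UNIV \<beta>"
    and bound: "\<And>t i j. \<bar>\<alpha> t $ i $ j\<bar> \<le> c" "\<And>t i j. \<bar>\<beta> t $ i $ j\<bar> \<le> c"
    and \<phi>: "continuous_on {-1..0} \<phi>"
  obtains y where "lin_dde \<alpha> \<beta> y" "\<And>s. s \<in> {-1..0} \<Longrightarrow> y s = \<phi> s"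
proof -
  define M where "M = real CARD('n) * real CARD('n) * c + 1"
  have c: "0 \<le> c" using bound(1) by (meson abs_ge_zero order_trans)
  have M: "M > 0" unfolding M_def using c by (simp add: add_nonneg_pos)
  have M\<alpha>: "norm (\<alpha> t *v x) \<le> M * norm x" for t x
    using norm_matrix_vector_le[of "\<alpha> t" c x] bound(1) unfolding M_def by (simp add: algebra_simps add_increasing)
  have M\<beta>: "norm (\<beta> t *v x) \<le> M * norm x" for t x
    using norm_matrix_vector_le[of "\<beta> t" c x] bound(2) unfolding M_def by (simp add: algebra_simps add_increasing)
  \<comment> \<open>Both terms of the equation contribute at most \<open>M\<close> times the weight,
    and integrating \<open>2 * M * exp (l * s)\<close> divides by \<open>l\<close>: the contraction
    factor is 2M/4M = 1/2.\<close>
  define l where "l = 4 * M"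
  define e where "e t = exp (l * max 0 t)" for t
  have e: "e t > 0" for t unfolding e_def by simp
  have ec: "continuous_on UNIV e" unfolding e_def[abs_def] by (intro continuous_intros)
  \<comment> \<open>The initial map, extended to the line by its end values; in particular it is
    constantly \<open>\<phi> 0\<close> for positive times.\<close>
  define p where "p t = \<phi> (max (-1) (min 0 t))" for t
  have pc: "continuous_on UNIV p" unfolding p_def
    by (rule continuous_on_compose2[OF \<phi>]) (auto intro!: continuous_intros)
  \<comment> \<open>The unknown \<open>w\<close> is the solution divided by the weight
    \<open>e\<close>, so the weighted norm becomes the ordinary supremum norm of bounded continuous
    functions.\<close>
  define F where "F w s = \<alpha> s *v (e s *\<^sub>R w s) + \<beta> s *v (e (s - 1) *\<^sub>R w (s - 1))" for w :: "real \<Rightarrow> real^'n" and s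
  have Fc: "continuous_on UNIV (F w)" if w: "continuous_on UNIV w" for w
  proof -
    have "continuous_on UNIV (\<lambda>s. e (s - 1))" "continuous_on UNIV (\<lambda>s. w (s - 1))"
      by (auto intro!: continuous_intros continuous_on_compose2[OF ec] continuous_on_compose2[OF w])
    then show ?thesis unfolding F_def[abs_def]
      by (intro continuous_on_add continuous_on_matrix_vector_mult cont continuous_on_scaleR ec w)
  qed
  define J where "J w t = integral {0..max 0 t} (F w)" for w t
  have Jd: "((\<lambda>u. integral {0..u} (F w)) has_vector_derivative F w t) (at t within {0..})"
    if "continuous_on UNIV w" "0 \<le> t" for w t
    by (rule integral_from_zero_vector_derivative[OF Fc[OF that(1)] that(2)])
  have Jc: "continuous_on UNIV (J w)" if w: "continuous_on UNIV w" for w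
  proof -
    have "continuous_on {0..} (\<lambda>u. integral {0..u} (F w))"
      unfolding continuous_on_eq_continuous_within
      using Jd[OF w] has_vector_derivative_continuous by blast
    then show ?thesis unfolding J_def[abs_def]
      by (rule continuous_on_compose2) (auto intro!: continuous_intros)
  qed
  have Jdiff: "norm (J v t - J w t) \<le> e t * (d / 2)"
    if v: "continuous_on UNIV v" and w: "continuous_on UNIV w" and d: "\<And>s. norm (v s - w s) \<le> d" for v w d t
  proof -
    have d0: "0 \<le> d" using d norm_ge_zero order_trans by blast
    have Fd: "norm (F v s - F w s) \<le> 2 * M * d * exp (l * s)" if s: "0 \<le> s" for s
    proof -
      have "F v s - F w s = \<alpha> s *v (e s *\<^sub>R (v s - w s)) + \<beta> s *v (e (s - 1) *\<^sub>R (v (s - 1) - w (s - 1)))"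
        unfolding F_def by (simp add: matrix_vector_right_distrib matrix_vector_mult_diff_distrib scaleR_diff_right)
      also have "norm \<dots> \<le> M * norm (e s *\<^sub>R (v s - w s)) + M * norm (e (s - 1) *\<^sub>R (v (s - 1) - w (s - 1)))"
        by (rule norm_triangle_le[OF add_mono[OF M\<alpha> M\<beta>]])
      also have "\<dots> \<le> M * (e s * d) + M * (e s * d)"
      proof (intro add_mono mult_left_mono)
        show "norm (e s *\<^sub>R (v s - w s)) \<le> e s * d" using d[of s] e[of s] by simp
        have "e (s - 1) \<le> e s" unfolding e_def l_def using M by (simp add: mult_left_mono)
        then show "norm (e (s - 1) *\<^sub>R (v (s - 1) - w (s - 1))) \<le> e s * d"
          using d[of "s - 1"] e[of "s - 1"] d0 by (simp add: mult_mono)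
      qed (use M in auto)
      finally show ?thesis using s unfolding e_def by (simp add: algebra_simps)
    qed
    define r where "r = max 0 t"
    have r: "0 \<le> r" unfolding r_def by simp
    have io: "F v integrable_on {0..r}" "F w integrable_on {0..r}"
      using continuous_on_subset[OF Fc] v w by (auto intro!: integrable_continuous_real)
    have ex: "((\<lambda>s. 2 * M * d * exp (l * s)) has_integral (d / 2 * exp (l * r) - d / 2 * exp (l * 0))) {0..r}"
      by (rule fundamental_theorem_of_calculus[OF r])
        (use M in \<open>auto intro!: derivative_eq_intros simp: l_def has_real_derivative_iff_has_vector_derivative[symmetric]\<close>)
    have "norm (J v t - J w t) = norm (integral {0..r} (\<lambda>s. F v s - F w s))"
      unfolding J_def r_def[symmetric] using io by (simp add: Henstock_Kurzweil_Integration.integral_diff)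
    also have "\<dots> \<le> integral {0..r} (\<lambda>s. 2 * M * d * exp (l * s))"
      by (rule integral_norm_bound_integral) (use io ex Fd in \<open>auto intro: integrable_diff\<close>)
    also have "\<dots> = d / 2 * exp (l * r) - d / 2" using integral_unique[OF ex] by simp
    also have "\<dots> \<le> e t * (d / 2)" unfolding e_def r_def[symmetric] using d0 by simp
    finally show ?thesis .
  qed
  define K where "K w t = (1 / e t) *\<^sub>R (p t + J w t)" for w t
  have K: "K (apply_bcontfun w) \<in> bcontfun" for w :: "real \<Rightarrow>\<^sub>C (real^'n)"
    unfolding bcontfun_def
  proof (intro CollectI conjI)
    show "continuous_on UNIV (K w)" unfolding K_def[abs_def]
      by (intro continuous_intros ec pc Jc) (use e in \<open>auto simp: less_imp_neq[THEN not_sym]\<close>)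
    have "compact (\<phi> ` {-1..0})" by (intro compact_continuous_image \<phi>) auto
    then obtain B where B: "\<And>s. s \<in> {-1..0} \<Longrightarrow> norm (\<phi> s) \<le> B"
      using compact_imp_bounded bounded_iff by (metis image_eqI)
    obtain D where D: "\<And>t. norm (apply_bcontfun w t) \<le> D"
      using bounded_apply_bcontfun[of w] unfolding bounded_iff by auto
    have "norm (K w t) \<le> B + D / 2" for t
    proof -
      have "norm (J w t - J (\<lambda>_. 0) t) \<le> e t * (D / 2)" by (rule Jdiff) (use D in auto)
      moreover have "J (\<lambda>_. 0) t = 0" unfolding J_def F_def by simp
      moreover have "norm (p t) \<le> B" unfolding p_def by (rule B) auto
      moreover have "B \<le> e t * B"
      proof -
        have "0 \<le> B" using B[of 0] by (meson atLeastAtMost_iff norm_ge_zero order_refl order_trans zero_le_one neg_le_0_iff_le)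
        moreover have "1 \<le> e t" unfolding e_def l_def using M by simp
        ultimately show ?thesis using mult_right_mono by fastforce
      qed
      ultimately have "norm (p t + J w t) \<le> e t * (B + D / 2)"
        using norm_triangle_ineq[of "p t" "J w t"] by (simp add: algebra_simps)
      then show ?thesis unfolding K_def using e[of t] by (simp add: pos_divide_le_eq mult.commute)
    qed
    then show "bounded (range (K w))" unfolding bounded_iff by blast
  qed
  define \<K> where "\<K> w = Bcontfun (K (apply_bcontfun w))" for w
  have \<K>: "apply_bcontfun (\<K> w) = K (apply_bcontfun w)" for w
    unfolding \<K>_def by (rule Bcontfun_inverse[OF K])
  have "\<exists>!w. \<K> w = w"
  proof (rule banach_fix_type[of "1/2"])
    show "\<forall>v w. dist (\<K> v) (\<K> w) \<le> 1/2 * dist v w"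
    proof (intro allI dist_bound)
      fix v w :: "real \<Rightarrow>\<^sub>C (real^'n)" and t
      have "norm (J v t - J w t) \<le> e t * (dist v w / 2)"
        by (rule Jdiff) (use dist_bounded[of v _ w] in \<open>auto simp: dist_norm\<close>)
      moreover have "K v t - K w t = (1 / e t) *\<^sub>R (J v t - J w t)"
        unfolding K_def by (simp add: algebra_simps)
      ultimately show "dist (apply_bcontfun (\<K> v) t) (apply_bcontfun (\<K> w) t) \<le> 1/2 * dist v w"
        unfolding \<K> dist_norm using e[of t] by (simp add: pos_divide_le_eq mult.commute)
    qed
  qed auto
  then obtain W where "\<K> W = W" by blast
  define w where "w = apply_bcontfun W"
  have w: "w t = K w t" for t using \<K>[of W] \<open>\<K> W = W\<close> unfolding w_def by simp
  have wc: "continuous_on UNIV w" unfolding w_def by simp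
  define y where "y t = e t *\<^sub>R w t" for t
  have y: "y t = p t + J w t" for t unfolding y_def using w[of t] e[of t] unfolding K_def by simp
  have "y s = \<phi> s" if "s \<in> {-1..0}" for s
  proof -
    have "max 0 s = 0" "max (-1) (min 0 s) = s" using that by auto
    then show ?thesis unfolding y p_def J_def by simp
  qed
  moreover have "lin_dde \<alpha> \<beta> y" unfolding lin_dde_def
  proof (intro conjI allI impI)
    show "continuous_on {-1..} y" unfolding y
      by (intro continuous_on_add continuous_on_subset[OF pc] continuous_on_subset[OF Jc[OF wc]]) auto
    fix t :: real assume t: "0 \<le> t"
    have "((\<lambda>u. p 0 + integral {0..u} (F w)) has_vector_derivative 0 + F w t) (at t within {0..})"
      by (intro has_vector_derivative_add has_vector_derivative_const Jd wc t)
    moreover have "p 0 + integral {0..u} (F w) = y u" if "u \<in> {0..}" for u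
      using that unfolding y J_def p_def by (simp add: max_def min_def)
    ultimately have "(y has_vector_derivative F w t) (at t within {0..})"
      using t by (intro has_vector_derivative_transform[of t _ y "\<lambda>u. p 0 + integral {0..u} (F w)"]) auto
    then show "(y has_vector_derivative \<alpha> t *v y t + \<beta> t *v y (t - 1)) (at t within {0..})"
      unfolding F_def y_def .
  qed
  ultimately show ?thesis using that by blast
qed

text \<open>Up to the first zero of a component, the delayed and off-diagonal terms can be dropped.\<close>

lemma cooperative_supersolution_ge:
  fixes \<alpha> \<beta> :: "real \<Rightarrow> real^'n^'n" and z z' :: "real \<Rightarrow> real^'n"
  assumes zc: "continuous_on {-1..T} z"
    and zd: "\<And>t. t \<in> {0..T} \<Longrightarrow> (z has_vector_derivative z' t) (at t within {0..T})"
    and super: "\<And>t i. t \<in> {0..T} \<Longrightarrow> (\<alpha> t *v z t + \<beta> t *v z (t - 1)) $ i \<le> z' t $ i"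
    and off: "\<And>t i j. t \<in> {0..T} \<Longrightarrow> i \<noteq> j \<Longrightarrow> 0 \<le> \<alpha> t $ i $ j"
    and \<beta>: "\<And>t i j. t \<in> {0..T} \<Longrightarrow> 0 \<le> \<beta> t $ i $ j"
    and diag: "\<And>t i. t \<in> {0..T} \<Longrightarrow> - c \<le> \<alpha> t $ i $ i"
    and init: "\<And>s i. s \<in> {-1..0} \<Longrightarrow> 0 < z s $ i"
    and t: "t \<in> {0..T}"
  shows "exp (- (c * t)) * z 0 $ i \<le> z t $ i"
proof -
  \<comment> \<open>Multiplication by \<open>exp (c * u)\<close> compensates the diagonal
    coefficient. The derivative matters only at interior points \<open>s\<close>, where both
    \<open>s\<close> and \<open>s - 1\<close> lie in the range of assumed positivity.\<close>
  have step: "exp (- (c * t)) * z 0 $ i \<le> z t $ i"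
    if t: "t \<in> {0..T}" and pos: "\<And>s j. s \<in> {-1..<t} \<Longrightarrow> 0 < z s $ j" for t i
  proof -
    have "exp (c * 0) * z 0 $ i \<le> exp (c * t) * z t $ i"
    proof (rule DERIV_nonneg_imp_increasing_open[where f = "\<lambda>u. exp (c * u) * z u $ i"])
      fix s assume s: "0 < s" "s < t"
      then have sT: "s \<in> {0..T}" "s \<in> interior {0..T}" using t by auto
      have "(z has_vector_derivative z' s) (at s)"
        using zd[OF sT(1)] at_within_interior[OF sT(2)] by simp
      then have "((\<lambda>u. z u $ i) has_vector_derivative z' s $ i) (at s)"
        by (rule bounded_linear.has_vector_derivative[OF bounded_linear_vec_nth])
      then have zi: "((\<lambda>u. z u $ i) has_real_derivative z' s $ i) (at s)"
        by (simp add: has_real_derivative_iff_has_vector_derivative)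
      have "0 \<le> \<alpha> s $ i $ j * z s $ j + (if j = i then c * z s $ i else 0)" for j
        using off[OF sT(1), of i j] diag[OF sT(1), of i] pos[of s j] s
          mult_right_mono[of "- c" "\<alpha> s $ i $ i" "z s $ i"] by (auto simp: less_imp_le)
      then have "0 \<le> (\<Sum>j\<in>UNIV. \<alpha> s $ i $ j * z s $ j + (if j = i then c * z s $ i else 0))"
        by (intro sum_nonneg) auto
      then have "0 \<le> (\<alpha> s *v z s) $ i + c * z s $ i"
        by (simp add: matrix_vector_component sum.distrib)
      moreover have "0 \<le> (\<beta> s *v z (s - 1)) $ i" unfolding matrix_vector_component
        by (intro sum_nonneg mult_nonneg_nonneg \<beta>[OF sT(1)] less_imp_le[OF pos]) (use s in auto)
      ultimately have "0 \<le> c * z s $ i + z' s $ i" using super[OF sT(1), of i] by simp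
      then have "0 \<le> exp (c * s) * (c * z s $ i + z' s $ i)" by simp
      moreover have "((\<lambda>u. exp (c * u) * z u $ i) has_real_derivative exp (c * s) * (c * z s $ i + z' s $ i)) (at s)"
        by (auto intro!: derivative_eq_intros zi simp: algebra_simps)
      ultimately show "\<exists>y. ((\<lambda>u. exp (c * u) * z u $ i) has_real_derivative y) (at s) \<and> 0 \<le> y" by blast
    next
      have "continuous_on {0..t} z" using zc by (rule continuous_on_subset) (use t in auto)
      then show "continuous_on {0..t} (\<lambda>u. exp (c * u) * z u $ i)" by (intro continuous_intros)
    qed (use t in auto)
    then have "exp (- (c * t)) * z 0 $ i \<le> exp (- (c * t)) * (exp (c * t) * z t $ i)"
      by (intro mult_left_mono) auto
    then show ?thesis by (simp add: mult.assoc[symmetric] mult_exp_exp)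
  qed
  have pos: "0 < z s $ j" if "s \<in> {-1..T}" for s j
  proof (rule ccontr)
    assume neg: "\<not> 0 < z s $ j"
    \<comment> \<open>The times at which some component is not positive. A first such time
      \<open>r\<close> would exist by compactness, but \<open>step\<close> applied at
      \<open>r\<close> makes all components positive there.\<close>
    define S where "S = (\<Union>i. {s \<in> {0..T}. z s $ i \<le> 0})"
    have "continuous_on {0..T} z" using zc by (rule continuous_on_subset) auto
    then have "closed {s \<in> {0..T}. z s $ i \<le> 0}" for i
      by (intro continuous_on_closed_Collect_le continuous_intros) auto
    then have "closed S" unfolding S_def by (intro closed_UN) auto
    moreover have "S \<subseteq> {0..T}" unfolding S_def by auto
    ultimately have "compact S" by (meson bounded_closed_interval bounded_subset compact_eq_bounded_closed)
    moreover have "s \<in> S" unfolding S_def using neg that init[of s j] by (cases "s < 0") (auto simp: not_less)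
    ultimately obtain r where r: "r \<in> S" "\<And>u. u \<in> S \<Longrightarrow> r \<le> u"
      using compact_attains_inf[of S] by (metis empty_iff)
    have rT: "r \<in> {0..T}" using r(1) \<open>S \<subseteq> {0..T}\<close> by blast
    have "0 < z u $ k" if "u \<in> {-1..<r}" for u k
    proof (rule ccontr)
      assume "\<not> 0 < z u $ k"
      then have "u \<in> S" unfolding S_def using init[of u k] that rT by (cases "u < 0") (auto simp: not_less)
      then show False using r(2)[of u] that by auto
    qed
    from step[OF rT this] have "exp (- (c * r)) * z 0 $ k \<le> z r $ k" for k by blast
    moreover have "0 < exp (- (c * r)) * z 0 $ k" for k using init[of 0 k] by simp
    ultimately have "0 < z r $ k" for k using less_le_trans by blast
    then show False using r(1) unfolding S_def by (auto simp: not_le[symmetric])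
  qed
  show ?thesis by (rule step[OF t]) (use t pos in auto)
qed

text \<open>A Gronwall estimate by comparison: \<open>\<epsilon> * E\<close> in every component,
  plus or minus \<open>d\<close>, is a supersolution with positive initial values. The strict bound
  on the initial values provides this positivity.\<close>

lemma cooperative_perturbation_bound:
  fixes \<alpha> \<beta> :: "real \<Rightarrow> real^'n^'n" and d d' :: "real \<Rightarrow> real^'n"
  assumes dc: "continuous_on {-1..T} d"
    and dd: "\<And>t. t \<in> {0..T} \<Longrightarrow> (d has_vector_derivative d' t) (at t within {0..T})"
    and err: "\<And>t i. t \<in> {0..T} \<Longrightarrow> \<bar>(d' t - (\<alpha> t *v d t + \<beta> t *v d (t - 1))) $ i\<bar> \<le> \<epsilon>"
    and off: "\<And>t i j. t \<in> {0..T} \<Longrightarrow> i \<noteq> j \<Longrightarrow> 0 \<le> \<alpha> t $ i $ j"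
    and \<beta>: "\<And>t i j. t \<in> {0..T} \<Longrightarrow> 0 \<le> \<beta> t $ i $ j"
    and bound: "\<And>t i j. t \<in> {0..T} \<Longrightarrow> \<bar>\<alpha> t $ i $ j\<bar> \<le> c" "\<And>t i j. t \<in> {0..T} \<Longrightarrow> \<bar>\<beta> t $ i $ j\<bar> \<le> c"
    and init: "\<And>s i. s \<in> {-1..0} \<Longrightarrow> \<bar>d s $ i\<bar> < \<epsilon>"
    and c: "0 \<le> c" and t: "t \<in> {0..T}"
  shows "\<bar>d t $ i\<bar> \<le> \<epsilon> * exp ((2 * real CARD('n) * c + 1) * t)"
proof -
  \<comment> \<open>Each of the two matrices contributes at most \<open>CARD('n) * c\<close>, and
    the remaining 1 absorbs the error \<open>\<epsilon>\<close>.\<close>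
  define l where "l = 2 * real CARD('n) * c + 1"
  have l: "l > 0" unfolding l_def using c by (simp add: add_nonneg_pos)
  define E where "E s = exp (l * max 0 s)" for s
  have \<epsilon>: "\<epsilon> > 0" using init[of 0] by (meson abs_ge_zero atLeastAtMost_iff le_less_trans order_refl neg_le_0_iff_le zero_le_one)
  have pos: "0 \<le> \<epsilon> * E t + \<sigma> * d t $ i" if \<sigma>: "\<sigma> = 1 \<or> \<sigma> = -1" for \<sigma> :: real
  proof -
    define z where "z s = ((\<epsilon> * E s) *\<^sub>R 1) + \<sigma> *\<^sub>R d s" for s
    define z' where "z' s = ((\<epsilon> * (l * E s)) *\<^sub>R 1) + \<sigma> *\<^sub>R d' s" for s
    have "exp (- (c * t)) * z 0 $ i \<le> z t $ i"
    proof (rule cooperative_supersolution_ge[where z' = z' and T = T and \<alpha> = \<alpha> and \<beta> = \<beta>])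
      show "continuous_on {-1..T} z" unfolding z_def E_def by (intro continuous_intros dc)
      show "(z has_vector_derivative z' s) (at s within {0..T})" if s: "s \<in> {0..T}" for s
      proof -
        have "((\<lambda>s. ((\<epsilon> * exp (l * s)) *\<^sub>R 1) + \<sigma> *\<^sub>R d s) has_vector_derivative
            ((\<epsilon> * (l * exp (l * s))) *\<^sub>R 1) + \<sigma> *\<^sub>R d' s) (at s within {0..T})"
          by (intro has_vector_derivative_add bounded_linear.has_vector_derivative[OF bounded_linear_scaleR_right]
                bounded_linear.has_vector_derivative[OF bounded_linear_scaleR_left] dd s)
            (auto simp: has_real_derivative_iff_has_vector_derivative[symmetric] intro!: derivative_eq_intros)
        also have "(\<epsilon> * (l * exp (l * s))) *\<^sub>R 1 + \<sigma> *\<^sub>R d' s = z' s"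
          using s by (simp add: z'_def E_def max_def)
        finally show ?thesis
          by (rule has_vector_derivative_transform[OF s, rotated]) (simp add: z_def E_def max_def)
      qed
      show "(\<alpha> s *v z s + \<beta> s *v z (s - 1)) $ j \<le> z' s $ j" if s: "s \<in> {0..T}" for s j
      proof -
        have E1: "1 \<le> E s" "E (s - 1) \<le> E s" "0 \<le> E (s - 1)"
          unfolding E_def using l by (auto simp: mult_left_mono)
        have "(\<alpha> s *v ((\<epsilon> * E s) *\<^sub>R 1)) $ j \<le> real CARD('n) * c * (\<epsilon> * E s)"
          using abs_matrix_vector_component_le[of "\<alpha> s" c "(\<epsilon> * E s) *\<^sub>R 1" "\<epsilon> * E s" j] bound(1)[OF s] \<epsilon> E1
          by (auto simp: abs_le_iff)
        moreover have "(\<beta> s *v ((\<epsilon> * E (s - 1)) *\<^sub>R 1)) $ j \<le> real CARD('n) * c * (\<epsilon> * E s)"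
          using abs_matrix_vector_component_le[of "\<beta> s" c "(\<epsilon> * E (s - 1)) *\<^sub>R 1" "\<epsilon> * E s" j] bound(2)[OF s] \<epsilon> E1
          by (auto simp: abs_le_iff)
        moreover have "\<sigma> * (\<alpha> s *v d s + \<beta> s *v d (s - 1)) $ j \<le> \<sigma> * d' s $ j + \<epsilon>"
          using err[OF s, of j] \<sigma> by (auto simp: abs_le_iff)
        moreover have "\<epsilon> \<le> \<epsilon> * E s" using \<epsilon> E1 by simp
        moreover have "z' s $ j = real CARD('n) * c * (\<epsilon> * E s) + real CARD('n) * c * (\<epsilon> * E s) + \<epsilon> * E s + \<sigma> * d' s $ j"
          unfolding z'_def l_def by (simp add: algebra_simps)
        moreover have "(\<alpha> s *v z s + \<beta> s *v z (s - 1)) $ j = (\<alpha> s *v ((\<epsilon> * E s) *\<^sub>R 1)) $ j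
            + (\<beta> s *v ((\<epsilon> * E (s - 1)) *\<^sub>R 1)) $ j + \<sigma> * (\<alpha> s *v d s + \<beta> s *v d (s - 1)) $ j"
          unfolding z_def by (simp add: matrix_vector_right_distrib matrix_vector_mult_scaleR algebra_simps)
        ultimately show ?thesis by linarith
      qed
      show "0 < z s $ j" if "s \<in> {-1..0}" for s j
      proof -
        have "E s = 1" using that unfolding E_def by (simp add: max_def)
        then show ?thesis using init[OF that, of j] \<sigma> unfolding z_def by auto
      qed
      show "- c \<le> \<alpha> s $ j $ j" if "s \<in> {0..T}" for s j using bound(1)[OF that, of j j] by linarith
    qed (use off \<beta> t in auto)
    moreover have "0 < z 0 $ i" using init[of 0 i] \<sigma> unfolding z_def E_def by auto
    ultimately have "0 < z t $ i" by (meson exp_gt_zero less_le_trans mult_pos_pos)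
    then show ?thesis unfolding z_def by simp
  qed
  then show ?thesis using pos[of 1] pos[of "-1"] t unfolding E_def l_def by auto
qed

section \<open>Positivity and comparison of solutions\<close>

locale cooperative_dde =
  fixes \<alpha> \<beta> :: "real \<Rightarrow> real^'n^'n" and c :: real
  assumes cont: "continuous_on UNIV \<alpha>" "continuous_on UNIV \<beta>"
    and bound: "\<And>t i j. \<bar>\<alpha> t $ i $ j\<bar> \<le> c" "\<And>t i j. \<bar>\<beta> t $ i $ j\<bar> \<le> c"
    and off: "\<And>t i j. i \<noteq> j \<Longrightarrow> 0 \<le> \<alpha> t $ i $ j"
    and delayed: "\<And>t i j. 0 \<le> \<beta> t $ i $ j"
begin

lemma c_nonneg: "0 \<le> c"
  using bound(1) by (meson abs_ge_zero order_trans)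

lemma solution_ge_exp:
  assumes y: "lin_dde \<alpha> \<beta> y" and init: "\<And>s i. s \<in> {-1..0} \<Longrightarrow> 0 < y s $ i" and t: "0 \<le> t"
  shows "exp (- (c * t)) * y 0 $ i \<le> y t $ i"
proof (rule cooperative_supersolution_ge[where z' = "\<lambda>t. \<alpha> t *v y t + \<beta> t *v y (t - 1)" and T = t and \<alpha> = \<alpha> and \<beta> = \<beta>])
  show "continuous_on {-1..t} y"
    using y unfolding lin_dde_def by (auto intro: continuous_on_subset)
  show "(y has_vector_derivative \<alpha> s *v y s + \<beta> s *v y (s - 1)) (at s within {0..t})" if "s \<in> {0..t}" for s
    using y that unfolding lin_dde_def
    by (intro has_vector_derivative_within_subset[of _ _ _ "{0..}" "{0..t}"]) auto
  show "- c \<le> \<alpha> s $ j $ j" for s j using bound(1)[of s j j] by linarith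
qed (use init off delayed t in auto)

text \<open>Weakly positive data become strictly positive after adding a small multiple of the
  solution that starts from 1; the multiple then tends to 0.\<close>

lemma solution_nonneg:
  assumes y: "lin_dde \<alpha> \<beta> y" and init: "\<And>s i. s \<in> {-1..0} \<Longrightarrow> 0 \<le> y s $ i" and t: "-1 \<le> t"
  shows "0 \<le> y t $ i"
proof (cases "t \<le> 0")
  case False
  obtain u where u: "lin_dde \<alpha> \<beta> u" "\<And>s. s \<in> {-1..0} \<Longrightarrow> u s = 1"
    using lin_dde_exists[OF cont bound, of "\<lambda>_. 1"] by auto
  have "0 \<le> y t $ i + \<epsilon> * u t $ i" if \<epsilon>: "0 < \<epsilon>" for \<epsilon>
  proof -
    have pos: "0 < (1 *\<^sub>R y s + \<epsilon> *\<^sub>R u s) $ j" if "s \<in> {-1..0}" for s j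
      using init[OF that, of j] u(2)[OF that] \<epsilon> by simp
    have "exp (- (c * t)) * (1 *\<^sub>R y 0 + \<epsilon> *\<^sub>R u 0) $ i \<le> (1 *\<^sub>R y t + \<epsilon> *\<^sub>R u t) $ i"
      by (rule solution_ge_exp[OF lin_dde_combination[OF y u(1)] pos]) (use False in auto)
    moreover have "0 \<le> exp (- (c * t)) * (1 *\<^sub>R y 0 + \<epsilon> *\<^sub>R u 0) $ i"
      using pos[of 0 i] by (intro mult_nonneg_nonneg) auto
    ultimately show ?thesis by simp
  qed
  moreover have "((\<lambda>\<epsilon>. y t $ i + \<epsilon> * u t $ i) \<longlongrightarrow> y t $ i + 0 * u t $ i) (at_right 0)"
    by (intro tendsto_intros)
  ultimately show ?thesis
    by (intro tendsto_lowerbound[of _ "y t $ i" "at_right 0"]) (auto simp: eventually_at_filter)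
qed (use init t in auto)

lemma solution_le:
  assumes "lin_dde \<alpha> \<beta> y" "lin_dde \<alpha> \<beta> z" "\<And>s i. s \<in> {-1..0} \<Longrightarrow> k * y s $ i \<le> z s $ i" "-1 \<le> t"
  shows "k * y t $ i \<le> z t $ i"
  using solution_nonneg[OF lin_dde_combination[OF assms(1,2), of "- k" 1], of t i] assms(3,4) by simp

end

section \<open>Unit solutions over the flow and their dependence on the base point\<close>

locale cooperative_family =
  fixes \<sigma> :: "real \<Rightarrow> 'w::metric_space \<Rightarrow> 'w" and A B :: "'w \<Rightarrow> real^'n^'n" and c :: real
  assumes comp: "compact (UNIV :: 'w set)"
    and flow: "continuous_flow \<sigma>"
    and contAB: "continuous_on UNIV A" "continuous_on UNIV B"
    and coop: "cooperative A B"
    and boundAB: "\<And>w i j. \<bar>A w $ i $ j\<bar> \<le> c" "\<And>w i j. \<bar>B w $ i $ j\<bar> \<le> c"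
begin

lemma along_orbit: "cooperative_dde (\<lambda>t. A (\<sigma> t w)) (\<lambda>t. B (\<sigma> t w)) c"
proof
  show "continuous_on UNIV (\<lambda>t. A (\<sigma> t w))" "continuous_on UNIV (\<lambda>t. B (\<sigma> t w))"
    by (auto intro!: continuous_on_compose2[OF contAB(1) flow_continuous(1)[OF flow]]
        continuous_on_compose2[OF contAB(2) flow_continuous(1)[OF flow]])
qed (use boundAB coop in \<open>auto simp: cooperative_def\<close>)

lemma c_nonneg: "0 \<le> c"
  using cooperative_dde.c_nonneg[OF along_orbit] .

lemma dde_sol_solves:
  assumes "\<phi> \<in> phase_space"
  shows "lin_dde (\<lambda>t. A (\<sigma> t w)) (\<lambda>t. B (\<sigma> t w)) (dde_sol \<sigma> A B w \<phi>)"
    and "\<And>s. s \<in> {-1..0} \<Longrightarrow> dde_sol \<sigma> A B w \<phi> s = \<phi> s"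
proof -
  interpret cooperative_dde "\<lambda>t. A (\<sigma> t w)" "\<lambda>t. B (\<sigma> t w)" c by (rule along_orbit)
  have "continuous_on {-1..0} \<phi>" using assms unfolding phase_space_def by simp
  then obtain y where "lin_dde (\<lambda>t. A (\<sigma> t w)) (\<lambda>t. B (\<sigma> t w)) y" "\<And>s. s \<in> {-1..0} \<Longrightarrow> y s = \<phi> s"
    using lin_dde_exists[OF cont bound] by blast
  then have "is_dde_solution \<sigma> A B w \<phi> y" unfolding is_dde_solution_def lin_dde_def by blast
  then have *: "is_dde_solution \<sigma> A B w \<phi> (dde_sol \<sigma> A B w \<phi>)"
    unfolding dde_sol_def by (rule someI[of "is_dde_solution \<sigma> A B w \<phi>"])
  then show "lin_dde (\<lambda>t. A (\<sigma> t w)) (\<lambda>t. B (\<sigma> t w)) (dde_sol \<sigma> A B w \<phi>)"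
    "\<And>s. s \<in> {-1..0} \<Longrightarrow> dde_sol \<sigma> A B w \<phi> s = \<phi> s"
    unfolding is_dde_solution_def lin_dde_def by blast+
qed

definition unit_sol :: "'w \<Rightarrow> real \<Rightarrow> real^'n" where
  "unit_sol w = dde_sol \<sigma> A B w (\<lambda>_. 1)"

lemma unit_sol_solves: "lin_dde (\<lambda>t. A (\<sigma> t w)) (\<lambda>t. B (\<sigma> t w)) (unit_sol w)"
  and unit_sol_init: "s \<in> {-1..0} \<Longrightarrow> unit_sol w s = 1"
  unfolding unit_sol_def using dde_sol_solves[where \<phi> = "\<lambda>_. 1"] by (auto simp: phase_space_def)

lemma unit_sol_derivative:
  assumes "t \<in> {0..T}"
  shows "(unit_sol w has_vector_derivative (A (\<sigma> t w) *v unit_sol w t + B (\<sigma> t w) *v unit_sol w (t - 1))) (at t within {0..T})"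
  using unit_sol_solves[of w] assms unfolding lin_dde_def
  by (intro has_vector_derivative_within_subset[of _ _ _ "{0..}" "{0..T}"]) auto

lemma unit_sol_continuous: "continuous_on {-1..T} (unit_sol w)"
  using unit_sol_solves[of w] unfolding lin_dde_def by (auto intro: continuous_on_subset)

text \<open>The factor 2 makes the initial value 1 of \<open>unit_sol\<close> lie strictly below the
  bound, as \<open>cooperative_perturbation_bound\<close> demands.\<close>

definition growth_bound :: "real \<Rightarrow> real" where
  "growth_bound t = 2 * exp ((2 * real CARD('n) * c + 1) * t)"

lemma growth_bound_mono: "s \<le> t \<Longrightarrow> growth_bound s \<le> growth_bound t"
  unfolding growth_bound_def using c_nonneg by (simp add: mult_left_mono)

lemma unit_sol_ge: "s \<le> t \<Longrightarrow> -1 \<le> s \<Longrightarrow> 0 \<le> t \<Longrightarrow> exp (- (c * t)) \<le> unit_sol w s $ i"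
proof (cases "s \<le> 0")
  case True
  assume "0 \<le> t" "-1 \<le> s"
  then show ?thesis using unit_sol_init[of s w] True c_nonneg by simp
next
  case False
  assume "s \<le> t"
  interpret cooperative_dde "\<lambda>t. A (\<sigma> t w)" "\<lambda>t. B (\<sigma> t w)" c by (rule along_orbit)
  have "exp (- (c * t)) \<le> exp (- (c * s))" using \<open>s \<le> t\<close> c_nonneg by (simp add: mult_left_mono)
  also have "\<dots> \<le> unit_sol w s $ i"
    using solution_ge_exp[OF unit_sol_solves[of w], of s i] unit_sol_init[of _ w] False by simp
  finally show ?thesis .
qed

lemma abs_unit_sol_le: "s \<le> t \<Longrightarrow> -1 \<le> s \<Longrightarrow> 0 \<le> t \<Longrightarrow> \<bar>unit_sol w s $ i\<bar> \<le> growth_bound t"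
proof (cases "s \<le> 0")
  case True
  assume "0 \<le> t" "-1 \<le> s"
  moreover have "2 \<le> growth_bound t"
    using growth_bound_mono[OF \<open>0 \<le> t\<close>] by (simp add: growth_bound_def)
  ultimately show ?thesis using unit_sol_init[of s w] True by simp
next
  case False
  assume "s \<le> t"
  interpret cooperative_dde "\<lambda>t. A (\<sigma> t w)" "\<lambda>t. B (\<sigma> t w)" c by (rule along_orbit)
  have "\<bar>unit_sol w s $ i\<bar> \<le> growth_bound s" unfolding growth_bound_def
    by (rule cooperative_perturbation_bound[where \<alpha> = "\<lambda>t. A (\<sigma> t w)" and \<beta> = "\<lambda>t. B (\<sigma> t w)" and T = s
          and d' = "\<lambda>t. A (\<sigma> t w) *v unit_sol w t + B (\<sigma> t w) *v unit_sol w (t - 1)"])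
      (use unit_sol_continuous unit_sol_derivative off delayed bound c_nonneg unit_sol_init False in auto)
  also have "\<dots> \<le> growth_bound t" by (rule growth_bound_mono) fact
  finally show ?thesis .
qed

lemma coefficients_close:
  fixes M :: "'w \<Rightarrow> real^'n^'n"
  assumes M: "continuous_on UNIV M" and "0 < \<delta>"
  shows "\<exists>d>0. \<forall>v w. dist v w < d \<longrightarrow> (\<forall>t\<in>{0..T}. \<forall>i j. \<bar>(M (\<sigma> t v) - M (\<sigma> t w)) $ i $ j\<bar> \<le> \<delta>)"
proof -
  have "continuous_on ({0..T} \<times> UNIV) (\<lambda>(t, w). \<sigma> t w)"
    using flow unfolding continuous_flow_def by (auto intro: continuous_on_subset)
  then have "continuous_on ({0..T} \<times> UNIV) (\<lambda>p. M (case p of (t, w) \<Rightarrow> \<sigma> t w))"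
    by (rule continuous_on_compose2[OF M]) auto
  moreover have "compact ({0..T} \<times> (UNIV :: 'w set))" by (intro compact_Times comp compact_Icc)
  ultimately have "uniformly_continuous_on ({0..T} \<times> UNIV) (\<lambda>p. M (case p of (t, w) \<Rightarrow> \<sigma> t w))"
    by (rule compact_uniformly_continuous)
  then obtain d where d: "d > 0" and close: "\<And>p q. p \<in> {0..T} \<times> UNIV \<Longrightarrow> q \<in> {0..T} \<times> UNIV \<Longrightarrow> dist q p < d \<Longrightarrow>
      dist (M (case q of (t, w) \<Rightarrow> \<sigma> t w)) (M (case p of (t, w) \<Rightarrow> \<sigma> t w)) < \<delta>"
    unfolding uniformly_continuous_on_def using \<open>0 < \<delta>\<close> by meson
  have "\<bar>(M (\<sigma> t v) - M (\<sigma> t w)) $ i $ j\<bar> \<le> \<delta>" if "dist v w < d" "t \<in> {0..T}" for v w t i j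
  proof -
    have "norm (M (\<sigma> t v) - M (\<sigma> t w)) < \<delta>"
      using close[of "(t, w)" "(t, v)"] that by (simp add: dist_Pair_Pair dist_norm)
    then show ?thesis
      using component_le_norm_cart[of "(M (\<sigma> t v) - M (\<sigma> t w)) $ i" j]
        Finite_Cartesian_Product.norm_nth_le[where x = "M (\<sigma> t v) - M (\<sigma> t w)" and i = i] by linarith
  qed
  then show ?thesis using d by blast
qed

text \<open>The difference of two unit solutions has zero initial data and solves the equation at
  \<open>v\<close> up to an error: the difference of the coefficients applied to the bounded
  function \<open>unit_sol w\<close>.\<close>

lemma unit_sol_close:
  assumes T: "0 \<le> T" and e: "0 < e"
  shows "\<exists>d>0. \<forall>v w. dist v w < d \<longrightarrow> (\<forall>s\<in>{-1..T}. \<forall>i. \<bar>unit_sol v s $ i - unit_sol w s $ i\<bar> \<le> e)"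
proof -
  let ?n = "real CARD('n)"
  have gT: "growth_bound T > 0" unfolding growth_bound_def by simp
  \<comment> \<open>Chosen so that the final bound \<open>\<epsilon> * growth_bound T / 2\<close> is
    \<open>e\<close>; then \<open>\<delta>\<close> is chosen so that the errors from
    \<open>A\<close> and \<open>B\<close> are at most \<open>\<epsilon> / 2\<close> each.\<close>
  define \<epsilon> where "\<epsilon> = 2 * e / growth_bound T"
  define \<delta> where "\<delta> = \<epsilon> / (2 * ?n * growth_bound T)"
  have \<epsilon>: "\<epsilon> > 0" unfolding \<epsilon>_def using gT e by simp
  have \<delta>: "\<delta> > 0" unfolding \<delta>_def using \<epsilon> gT by simp
  obtain d1 where d1: "d1 > 0"
    "\<And>v w t i j. dist v w < d1 \<Longrightarrow> t \<in> {0..T} \<Longrightarrow> \<bar>(A (\<sigma> t v) - A (\<sigma> t w)) $ i $ j\<bar> \<le> \<delta>"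
    using coefficients_close[OF contAB(1) \<delta>, of T] by meson
  obtain d2 where d2: "d2 > 0"
    "\<And>v w t i j. dist v w < d2 \<Longrightarrow> t \<in> {0..T} \<Longrightarrow> \<bar>(B (\<sigma> t v) - B (\<sigma> t w)) $ i $ j\<bar> \<le> \<delta>"
    using coefficients_close[OF contAB(2) \<delta>, of T] by meson
  have "\<bar>unit_sol v s $ i - unit_sol w s $ i\<bar> \<le> e" if vw: "dist v w < min d1 d2" and s: "s \<in> {-1..T}" for v w s i
  proof (cases "s \<le> 0")
    case True
    then show ?thesis using unit_sol_init s e by simp
  next
    case False
    interpret cooperative_dde "\<lambda>t. A (\<sigma> t v)" "\<lambda>t. B (\<sigma> t v)" c by (rule along_orbit)
    define D where "D t = unit_sol v t - unit_sol w t" for t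
    define D' where "D' t = (A (\<sigma> t v) *v unit_sol v t + B (\<sigma> t v) *v unit_sol v (t - 1))
      - (A (\<sigma> t w) *v unit_sol w t + B (\<sigma> t w) *v unit_sol w (t - 1))" for t
    have "\<bar>D s $ i\<bar> \<le> \<epsilon> * exp ((2 * ?n * c + 1) * s)"
    proof (rule cooperative_perturbation_bound[where \<alpha> = "\<lambda>t. A (\<sigma> t v)" and \<beta> = "\<lambda>t. B (\<sigma> t v)" and T = T])
      show "continuous_on {-1..T} D" unfolding D_def by (intro continuous_intros unit_sol_continuous)
      show "(D has_vector_derivative D' t) (at t within {0..T})" if "t \<in> {0..T}" for t
        unfolding D_def D'_def by (intro has_vector_derivative_diff unit_sol_derivative that)
      show "\<bar>(D' t - (A (\<sigma> t v) *v D t + B (\<sigma> t v) *v D (t - 1))) $ j\<bar> \<le> \<epsilon>" if t: "t \<in> {0..T}" for t j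
      proof -
        have ub: "\<bar>unit_sol w t $ k\<bar> \<le> growth_bound T" "\<bar>unit_sol w (t - 1) $ k\<bar> \<le> growth_bound T" for k
          using abs_unit_sol_le[of t T w k] abs_unit_sol_le[of "t - 1" T w k] t by auto
        have eq: "D' t - (A (\<sigma> t v) *v D t + B (\<sigma> t v) *v D (t - 1))
          = (A (\<sigma> t v) - A (\<sigma> t w)) *v unit_sol w t + (B (\<sigma> t v) - B (\<sigma> t w)) *v unit_sol w (t - 1)"
          unfolding D_def D'_def by (simp add: matrix_vector_mult_diff_distrib matrix_vector_mult_diff_rdistrib)
        have "\<bar>((A (\<sigma> t v) - A (\<sigma> t w)) *v unit_sol w t) $ j\<bar> \<le> ?n * \<delta> * growth_bound T"
          by (rule abs_matrix_vector_component_le) (use d1(2) vw t ub in auto)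
        moreover have "\<bar>((B (\<sigma> t v) - B (\<sigma> t w)) *v unit_sol w (t - 1)) $ j\<bar> \<le> ?n * \<delta> * growth_bound T"
          by (rule abs_matrix_vector_component_le) (use d2(2) vw t ub in auto)
        moreover have "?n * \<delta> * growth_bound T + ?n * \<delta> * growth_bound T = \<epsilon>"
          unfolding \<delta>_def using gT by (simp add: field_simps)
        ultimately show ?thesis unfolding eq vector_add_component
          by (intro order_trans[OF abs_triangle_ineq]) linarith
      qed
      show "\<bar>D r $ k\<bar> < \<epsilon>" if "r \<in> {-1..0}" for r k
        unfolding D_def using unit_sol_init[OF that] \<epsilon> by simp
    qed (use off delayed bound c_nonneg False s in auto)
    also have "\<dots> = \<epsilon> * (growth_bound s / 2)" unfolding growth_bound_def by simp
    also have "\<dots> \<le> \<epsilon> * (growth_bound T / 2)"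
      using growth_bound_mono[of s T] s \<epsilon> by (intro mult_left_mono) auto
    also have "\<dots> = e" unfolding \<epsilon>_def using gT by simp
    finally show ?thesis unfolding D_def by simp
  qed
  then show ?thesis using d1(1) d2(1) by (intro exI[of _ "min d1 d2"]) auto
qed

text \<open>The window has the length of the delay, so that \<open>growth\<close> bounds a whole
  history segment from below and the equation can be restarted from that segment.\<close>

definition growth :: "real \<Rightarrow> 'w \<Rightarrow> real" where
  "growth t w = (INF p\<in>{t-1..t} \<times> UNIV. unit_sol w (fst p) $ snd p)"

lemma growth_le: "0 \<le> t \<Longrightarrow> s \<in> {t-1..t} \<Longrightarrow> growth t w \<le> unit_sol w s $ i"
proof -
  assume t: "0 \<le> t" "s \<in> {t-1..t}"
  have "bdd_below ((\<lambda>p. unit_sol w (fst p) $ snd p) ` ({t-1..t} \<times> UNIV))"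
    by (rule bdd_belowI2[of _ "exp (- (c * t))"]) (use unit_sol_ge t in auto)
  from cINF_lower[OF this, of "(s, i)"] show ?thesis unfolding growth_def using t by simp
qed

lemma le_growth: "(\<And>s i. s \<in> {t-1..t} \<Longrightarrow> k \<le> unit_sol w s $ i) \<Longrightarrow> k \<le> growth t w"
  unfolding growth_def by (rule cINF_greatest) auto

lemma unit_sol_shift_solves:
  assumes "0 \<le> s"
  shows "lin_dde (\<lambda>t. A (\<sigma> t (\<sigma> s w))) (\<lambda>t. B (\<sigma> t (\<sigma> s w))) (\<lambda>t. unit_sol w (s + t))"
  using lin_dde_shift[OF unit_sol_solves assms] by (simp add: flow_add[OF flow])

lemma growth_cocycle: "growth_cocycle \<sigma> growth c growth_bound"
proof
  show "compact (UNIV :: 'w set)" "continuous_flow \<sigma>" "0 \<le> c" by (fact comp flow c_nonneg)+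
  show "0 < growth_bound s" for s unfolding growth_bound_def by simp
  show "exp (- (c * t)) \<le> growth t w" if "0 \<le> t" for t w
    by (rule le_growth) (use unit_sol_ge that in auto)
  \<comment> \<open>Restarted at time \<open>s\<close>, \<open>unit_sol w\<close> has a history
    above \<open>growth s w\<close> times the constant 1, and comparison keeps it above that
    multiple of \<open>unit_sol (\<sigma> s w)\<close>.\<close>
  show "growth s w * growth t (\<sigma> s w) \<le> growth (s + t) w" if st: "0 \<le> s" "0 \<le> t" for s t w
  proof (rule le_growth)
    fix r i assume r: "r \<in> {s + t - 1..s + t}"
    interpret cooperative_dde "\<lambda>t. A (\<sigma> t (\<sigma> s w))" "\<lambda>t. B (\<sigma> t (\<sigma> s w))" c by (rule along_orbit)
    have "0 \<le> growth s w" by (rule le_growth) (use st in \<open>auto intro: order_trans[OF exp_ge_zero unit_sol_ge]\<close>)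
    then have "growth s w * growth t (\<sigma> s w) \<le> growth s w * unit_sol (\<sigma> s w) (r - s) $ i"
      using st r by (intro mult_left_mono growth_le) auto
    also have "growth s w * unit_sol (\<sigma> s w) (r - s) $ i \<le> unit_sol w (s + (r - s)) $ i"
      by (rule solution_le[OF unit_sol_solves unit_sol_shift_solves]) (use st r unit_sol_init growth_le in auto)
    finally show "growth s w * growth t (\<sigma> s w) \<le> unit_sol w r $ i" by simp
  qed
  \<comment> \<open>The reverse comparison: the history of \<open>unit_sol w\<close> at time
    \<open>s\<close> is at most \<open>growth_bound s\<close> times the constant 1.\<close>
  show "growth (s + t) w \<le> growth_bound s * growth t (\<sigma> s w)" if st: "0 \<le> s" "0 \<le> t" for s t w
  proof -
    have g: "growth_bound s > 0" unfolding growth_bound_def by simp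
    have "growth (s + t) w / growth_bound s \<le> growth t (\<sigma> s w)"
    proof (rule le_growth)
      fix r i assume r: "r \<in> {t - 1..t}"
      interpret cooperative_dde "\<lambda>t. A (\<sigma> t (\<sigma> s w))" "\<lambda>t. B (\<sigma> t (\<sigma> s w))" c by (rule along_orbit)
      have init: "1 / growth_bound s * unit_sol w (s + q) $ j \<le> unit_sol (\<sigma> s w) q $ j" if "q \<in> {-1..0}" for q j
        using abs_unit_sol_le[of "s + q" s w j] that st g unit_sol_init[OF that] by (simp add: pos_divide_le_eq)
      have "1 / growth_bound s * growth (s + t) w \<le> 1 / growth_bound s * unit_sol w (s + r) $ i"
        using g st r by (intro mult_left_mono growth_le) auto
      also have "\<dots> \<le> unit_sol (\<sigma> s w) r $ i"
        by (rule solution_le[OF unit_sol_shift_solves unit_sol_solves init]) (use st r in auto)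
      finally show "growth (s + t) w / growth_bound s \<le> unit_sol (\<sigma> s w) r $ i" by simp
    qed
    then show ?thesis using g by (simp add: pos_divide_le_eq mult.commute)
  qed
  show "continuous_on UNIV (growth t)" if t: "0 \<le> t" for t
    unfolding continuous_on_iff
  proof (intro ballI allI impI)
    fix w :: 'w and e :: real assume "e > 0"
    then obtain d where d: "d > 0" "\<And>v w s i. dist v w < d \<Longrightarrow> s \<in> {-1..t} \<Longrightarrow> \<bar>unit_sol v s $ i - unit_sol w s $ i\<bar> \<le> e / 2"
      using unit_sol_close[OF t, of "e / 2"] by (metis half_gt_zero)
    have half: "growth t v \<le> growth t w + e / 2" if "dist v w < d" for v w
    proof -
      have "growth t v - e / 2 \<le> growth t w"
      proof (rule le_growth)
        fix s i assume s: "s \<in> {t-1..t}"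
        then have "\<bar>unit_sol v s $ i - unit_sol w s $ i\<bar> \<le> e / 2" using t by (intro d(2)[OF that]) auto
        then show "growth t v - e / 2 \<le> unit_sol w s $ i"
          using growth_le[OF t s, of v i] by linarith
      qed
      then show ?thesis by simp
    qed
    then show "\<exists>d>0. \<forall>v\<in>UNIV. dist v w < d \<longrightarrow> dist (growth t v) (growth t w) < e"
      using d(1) \<open>e > 0\<close> half[of _ w] half[of w]
      by (intro exI[of _ d]) (force simp: dist_real_def dist_commute abs_less_iff)
  qed
qed

section \<open>Persistence expressed by divergence of the growth\<close>

lemma growing_of_persistent:
  assumes "system_uniformly_persistent \<sigma> A B w"
  shows "w \<in> growth_cocycle.growing growth"
  unfolding growth_cocycle.growing_iff[OF growth_cocycle]
proof
  fix k :: real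
  interpret cooperative_dde "\<lambda>t. A (\<sigma> t w)" "\<lambda>t. B (\<sigma> t w)" c by (rule along_orbit)
  define K where "K = max 1 k"
  have K: "K > 0" "k \<le> K" unfolding K_def by auto
  obtain m where m: "m > 0" and pers: "\<And>\<phi>. \<phi> \<in> phase_space \<Longrightarrow> strongly_positive \<phi> \<Longrightarrow>
      \<exists>t0\<ge>0. \<forall>t\<ge>t0. \<forall>i. m \<le> dde_sol \<sigma> A B w \<phi> t $ i"
    using assms unfolding system_uniformly_persistent_def by blast
  \<comment> \<open>The level \<open>m\<close> is the same for all initial maps, so it is reached
    even from the constant \<open>m / K\<close>; scaling by \<open>K / m\<close> lifts the unit
    solution to \<open>K\<close>.\<close>
  define \<phi> :: "real \<Rightarrow> real^'n" where "\<phi> = (\<lambda>_. (m / K) *\<^sub>R 1)"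
  have \<phi>: "\<phi> \<in> phase_space" "strongly_positive \<phi>"
    unfolding \<phi>_def phase_space_def strongly_positive_def using m K by auto
  obtain t0 where t0: "t0 \<ge> 0" "\<And>t i. t \<ge> t0 \<Longrightarrow> m \<le> dde_sol \<sigma> A B w \<phi> t $ i" using pers[OF \<phi>] by blast
  have "K \<le> unit_sol w t $ i" if "t \<ge> t0" for t i
  proof -
    have "K / m * dde_sol \<sigma> A B w \<phi> t $ i \<le> unit_sol w t $ i"
      by (rule solution_le[OF dde_sol_solves(1)[OF \<phi>(1)] unit_sol_solves])
        (use t0(1) that m K dde_sol_solves(2)[OF \<phi>(1)] unit_sol_init in \<open>auto simp: \<phi>_def\<close>)
    moreover have "K / m * m \<le> K / m * dde_sol \<sigma> A B w \<phi> t $ i"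
      using m K by (intro mult_left_mono t0(2) that) auto
    ultimately show ?thesis using m by simp
  qed
  \<comment> \<open>The extra 1 is the length of the window that \<open>growth\<close> looks back
    over.\<close>
  then have "k \<le> growth t w" if "t \<ge> t0 + 1" for t
    using that K by (intro le_growth) (auto intro: order_trans[OF K(2)])
  then show "\<exists>N\<ge>0. \<forall>t\<ge>N. k \<le> growth t w" using t0(1) by (intro exI[of _ "t0 + 1"]) auto
qed

lemma family_persistent_of_growing:
  assumes "growth_cocycle.growing growth = UNIV"
  shows "family_uniformly_persistent \<sigma> A B"
  unfolding family_uniformly_persistent_def
proof (intro bexI[of _ "\<lambda>_. 1"] conjI allI ballI impI)
  show "(\<lambda>_. 1) \<in> phase_space" "strongly_positive (\<lambda>_. 1)"
    unfolding phase_space_def strongly_positive_def by auto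
  fix w and \<phi> :: "real \<Rightarrow> real^'n" assume \<phi>: "\<phi> \<in> phase_space" "strongly_positive \<phi>"
  interpret cooperative_dde "\<lambda>t. A (\<sigma> t w)" "\<lambda>t. B (\<sigma> t w)" c by (rule along_orbit)
  \<comment> \<open>Compactness of \<open>{-1..0}\<close> turns pointwise positivity into a positive
    constant below \<open>\<phi>\<close>; growth by \<open>1 / \<epsilon>\<close> then lifts the
    solution above 1.\<close>
  have "\<exists>\<epsilon>>0. \<forall>s\<in>{-1..0}. \<epsilon> \<le> \<phi> s $ i" for i
  proof -
    have "continuous_on {-1..0} (\<lambda>s. \<phi> s $ i)"
      using \<phi>(1) unfolding phase_space_def by (auto intro!: continuous_intros)
    then obtain r where "r \<in> {-1..0}" "\<forall>s\<in>{-1..0}. \<phi> r $ i \<le> \<phi> s $ i"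
      using continuous_attains_inf[of "{-1..0::real}" "\<lambda>s. \<phi> s $ i"] by auto
    then show ?thesis using \<phi>(2) unfolding strongly_positive_def by blast
  qed
  then obtain E where E: "\<And>i. E i > 0" "\<And>i s. s \<in> {-1..0} \<Longrightarrow> E i \<le> \<phi> s $ i" by metis
  define \<epsilon> where "\<epsilon> = Min (range E)"
  have \<epsilon>: "\<epsilon> > 0" "\<And>i. \<epsilon> \<le> E i" unfolding \<epsilon>_def using E(1) by auto
  have "w \<in> growth_cocycle.growing growth" using assms by simp
  then obtain t0 where t0: "t0 \<ge> 0" "\<And>t. t \<ge> t0 \<Longrightarrow> 1 / \<epsilon> \<le> growth t w"
    unfolding growth_cocycle.growing_iff[OF growth_cocycle] by blast
  have "phase_le (\<lambda>_. 1) (dde_segment \<sigma> A B t w \<phi>)" if "t \<ge> t0" for t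
    unfolding phase_le_def dde_segment_def
  proof (intro ballI allI)
    fix s i assume s: "s \<in> {-1..0::real}"
    have "1 / \<epsilon> \<le> unit_sol w (t + s) $ i"
      using t0(2)[OF that] growth_le[of t "t + s" w i] t0(1) that s by auto
    then have "1 \<le> \<epsilon> * unit_sol w (t + s) $ i" using \<epsilon>(1) by (simp add: pos_divide_le_eq mult.commute)
    also have "\<dots> \<le> dde_sol \<sigma> A B w \<phi> (t + s) $ i"
    proof (rule solution_le[OF unit_sol_solves dde_sol_solves(1)[OF \<phi>(1)]])
      fix q j assume q: "q \<in> {-1..0::real}"
      show "\<epsilon> * unit_sol w q $ j \<le> dde_sol \<sigma> A B w \<phi> q $ j"
        using \<epsilon>(2)[of j] E(2)[OF q, of j] unit_sol_init[OF q] dde_sol_solves(2)[OF \<phi>(1) q] by simp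
    qed (use t0(1) that s in auto)
    finally show "(1 :: real^'n) $ i \<le> dde_sol \<sigma> A B w \<phi> (t + s) $ i" by simp
  qed
  then show "\<exists>t0\<ge>0. \<forall>t\<ge>t0. phase_le (\<lambda>_. 1) (dde_segment \<sigma> A B t w \<phi>)" using t0(1) by blast
qed

end

lemma compact_matrix_entries_bounded:
  fixes M :: "'w::metric_space \<Rightarrow> real^'n^'n"
  assumes "compact (UNIV :: 'w set)" "continuous_on UNIV M"
  obtains c where "\<And>w i j. \<bar>M w $ i $ j\<bar> \<le> c"
proof -
  have "bounded (range M)"
    using compact_continuous_image[OF assms(2,1)] by (rule compact_imp_bounded)
  then obtain c where c: "\<And>w. norm (M w) \<le> c" by (auto simp: bounded_iff)
  have "\<bar>M w $ i $ j\<bar> \<le> c" for w i j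
    using component_le_norm_cart[of "M w $ i" j] Finite_Cartesian_Product.norm_nth_le[where x = "M w" and i = i] c[of w]
    by linarith
  then show ?thesis using that by blast
qed

theorem theorem4p3:
  fixes \<sigma> :: "real \<Rightarrow> 'w::metric_space \<Rightarrow> 'w"
    and \<mu> :: "'w measure"
    and A B :: "'w \<Rightarrow> real^'n^'n"
    and \<omega>\<^sub>0 :: 'w
  assumes "compact (UNIV :: 'w set)"
    and "continuous_flow \<sigma>"
    and "minimal_flow \<sigma>"
    and "uniquely_ergodic \<sigma>"
    and "invariant_prob \<sigma> \<mu>"
    and "continuous_on UNIV A"
    and "continuous_on UNIV B"
    and "cooperative A B"
    and "system_uniformly_persistent \<sigma> A B \<omega>\<^sub>0"
    and "\<not> family_uniformly_persistent \<sigma> A B"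
  shows "\<exists>\<Omega>\<^sub>1. invariant_set \<sigma> \<Omega>\<^sub>1 \<and> residual_set \<Omega>\<^sub>1 \<and>
           \<Omega>\<^sub>1 \<in> sets borel \<and> emeasure \<mu> \<Omega>\<^sub>1 = 1 \<and>
           (\<forall>\<omega>\<in>\<Omega>\<^sub>1. \<not> system_uniformly_persistent \<sigma> A B \<omega>)"
proof -
  obtain a b where ab: "\<And>w i j. \<bar>A w $ i $ j\<bar> \<le> a" "\<And>w i j. \<bar>B w $ i $ j\<bar> \<le> b"
    using compact_matrix_entries_bounded[OF assms(1,6)] compact_matrix_entries_bounded[OF assms(1,7)]
    by metis
  interpret cooperative_family \<sigma> A B "max a b"
    using assms ab by unfold_locales (auto simp: le_max_iff_disj)
  interpret growth_cocycle \<sigma> growth "max a b" growth_bound by (rule growth_cocycle)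
  interpret prob_space \<mu> using assms(5) unfolding invariant_prob_def by blast
  have sets: "sets \<mu> = sets borel" using assms(5) unfolding invariant_prob_def by blast
  then have sp: "space \<mu> = UNIV" by (auto dest: sets_eq_imp_space_eq)
  have ne: "growing \<noteq> UNIV" using family_persistent_of_growing assms(10) by blast
  have "invariant_set \<sigma> (- growing)" unfolding invariant_set_def
  proof (intro allI equalityI subsetI)
    fix t w assume w: "w \<in> - growing"
    have "w = \<sigma> t (\<sigma> (- t) w)"
      using flow_zero[OF assms(2), of w] flow_add[OF assms(2), of "- t" t w] by simp
    then show "w \<in> \<sigma> t ` (- growing)" using w growing_flow_iff by (metis ComplD ComplI imageI)
  qed (auto simp: growing_flow_iff)
  moreover have "residual_set (- growing)"
    unfolding residual_set_def using growing_first_category[OF assms(3) ne] by simp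
  moreover have "emeasure \<mu> (- growing) = 1"
  proof -
    have "measure \<mu> (- growing) = 1"
      using prob_compl[of growing] growing_null[OF assms(4,5) ne] growing_borel sets sp
      by (simp add: Compl_eq_Diff_UNIV)
    then show ?thesis by (simp add: emeasure_eq_measure)
  qed
  ultimately show ?thesis
    using growing_borel growing_of_persistent by (intro exI[of _ "- growing"]) auto
qed

end
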